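(* Let $K$ be a field and $S=K[x_1,\dots,x_n]$ with the standard grading. Let $$E:\quad0\to E^0\to\cdots\to E^n\to0$$ be a complex of (finitely generated) graded free $S$-modules, let $\tau$ be a cohomological index ($0\le\tau\le n$) and let $c$ be an integer. If $\beta$ is the Betti diagram of a minimal free resolution of a finitely generated graded $S$-module, then $$\langle\beta,E\rangle_{c,\tau}\ge0.$$
   Context: All maps are homogeneous of degree $0$. The Betti diagram of a graded free resolution $F$ with $F_i=\bigoplus_kS(-k)^{\beta_{i,k}}$ is $\beta=(\beta_{i,k})$. Put $\gamma_{j,d}=\gamma_{j,d}(E)=\dim_KH^j(E)_d$. Then $\langle\beta,E\rangle_{c,\tau}$ is defined as $$\langle\beta,E\rangle_{c,\tau}=\sum_{\{i,j,k\,\mid\, j\le i\text{ and }(j<\tau\text{ or }j\le i-2)\}}(-1)^{i-j}\beta_{i,k}\gamma_{j,-k}\;+\sum_{\{i,j,k,\epsilon\,\mid\,0\le\epsilon\le1,\ j=\tau,\ i=j+\epsilon,\ k\le c+\epsilon\}}(-1)^{i-j}\beta_{i,k}\gamma_{j,-k}.$$ *)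

theory Defs
  imports HOL.Modules "HOL-Library.Poly_Mapping" "HOL-Library.Cardinality"
begin

text \<open>The polynomial ring \<open>S = K[x\<^sub>v | v \<in> 'v]\<close>: finitely supported maps from monomials
  (finitely supported exponent vectors) to coefficients, with the convolution product of
  \<^theory>\<open>HOL-Library.Poly_Mapping\<close>. The number of variables is \<open>CARD('v)\<close>.\<close>

type_synonym ('v, 'k) mpoly = "('v \<Rightarrow>\<^sub>0 nat) \<Rightarrow>\<^sub>0 'k"

definition mconst :: "'k::field \<Rightarrow> ('v, 'k) mpoly" where
  "mconst a = Poly_Mapping.single 0 a"

definition mvar :: "'v \<Rightarrow> ('v, 'k::field) mpoly" where
  "mvar v = Poly_Mapping.single (Poly_Mapping.single v 1) 1"

definition homogeneous :: "('v::finite, 'k::field) mpoly \<Rightarrow> int \<Rightarrow> bool" where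
  "homogeneous p d \<longleftrightarrow>
     (\<forall>m \<in> Poly_Mapping.keys p. (\<Sum>v\<in>UNIV. int (Poly_Mapping.lookup m v)) = d)"


text \<open>A graded \<open>S\<close>-module is given by its family of homogeneous components \<open>G d\<close>, as subsets of
  an ambient \<open>S\<close>-module which has no grading and may be larger. The module itself is
  the (internal direct) sum of the components, \<open>total s G\<close>. A common ambient module for the
  terms of a complex is no restriction: take the direct sum of the terms.\<close>

definition total ::
  "(('v::finite, 'k::field) mpoly \<Rightarrow> 'm::ab_group_add \<Rightarrow> 'm) \<Rightarrow> (int \<Rightarrow> 'm set) \<Rightarrow> 'm set" where
  "total s G = module.span s (\<Union>d. G d)"

locale graded_module = module s
  for s :: "('v::finite, 'k::field) mpoly \<Rightarrow> 'm::ab_group_add \<Rightarrow> 'm" +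
  fixes G :: "int \<Rightarrow> 'm set"
  assumes zero_comp: "0 \<in> G d"
    and add_comp: "x \<in> G d \<Longrightarrow> y \<in> G d \<Longrightarrow> x + y \<in> G d"
    and scale_comp: "homogeneous p e \<Longrightarrow> x \<in> G d \<Longrightarrow> s p x \<in> G (e + d)"
    and direct: "(\<And>d. f d \<in> G d) \<Longrightarrow> finite {d. f d \<noteq> 0} \<Longrightarrow>
                   (\<Sum>d | f d \<noteq> 0. f d) = 0 \<Longrightarrow> f d = 0"

definition finitely_generated ::
  "(('v::finite, 'k::field) mpoly \<Rightarrow> 'm::ab_group_add \<Rightarrow> 'm) \<Rightarrow> (int \<Rightarrow> 'm set) \<Rightarrow> bool" where
  "finitely_generated s G \<longleftrightarrow> (\<exists>B. finite B \<and> module.span s B = total s G)"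

definition graded_hom ::
  "(('v::finite, 'k::field) mpoly \<Rightarrow> 'm::ab_group_add \<Rightarrow> 'm) \<Rightarrow> (int \<Rightarrow> 'm set) \<Rightarrow>
   (('v, 'k) mpoly \<Rightarrow> 'n::ab_group_add \<Rightarrow> 'n) \<Rightarrow> (int \<Rightarrow> 'n set) \<Rightarrow> ('m \<Rightarrow> 'n) \<Rightarrow> bool" where
  "graded_hom s G t H f \<longleftrightarrow>
     (\<forall>x \<in> total s G. \<forall>y \<in> total s G. f (x + y) = f x + f y) \<and>
     (\<forall>p. \<forall>x \<in> total s G. f (s p x) = t p (f x)) \<and>
     (\<forall>d. f ` G d \<subseteq> H d)"

definition homogeneous_basis ::
  "(('v::finite, 'k::field) mpoly \<Rightarrow> 'm::ab_group_add \<Rightarrow> 'm) \<Rightarrow> (int \<Rightarrow> 'm set) \<Rightarrow> 'm set \<Rightarrow> bool"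
  where
  "homogeneous_basis s G B \<longleftrightarrow>
     B \<subseteq> (\<Union>d. G d) \<and> \<not> module.dependent s B \<and> module.span s B = total s G"

definition fg_graded_free ::
  "(('v::finite, 'k::field) mpoly \<Rightarrow> 'm::ab_group_add \<Rightarrow> 'm) \<Rightarrow> (int \<Rightarrow> 'm set) \<Rightarrow> bool" where
  "fg_graded_free s G \<longleftrightarrow> graded_module s G \<and> (\<exists>B. finite B \<and> homogeneous_basis s G B)"


text \<open>A complex \<open>0 \<rightarrow> E\<^sup>0 \<rightarrow> \<dots> \<rightarrow> E\<^sup>n \<rightarrow> 0\<close> is indexed by all natural numbers, with zero terms
  beyond \<open>n\<close>; the differential \<open>\<delta> j\<close> goes from \<open>E j\<close> to \<open>E (Suc j)\<close>.\<close>

definition free_complex ::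
  "nat \<Rightarrow> (('v::finite, 'k::field) mpoly \<Rightarrow> 'e::ab_group_add \<Rightarrow> 'e) \<Rightarrow>
   (nat \<Rightarrow> int \<Rightarrow> 'e set) \<Rightarrow> (nat \<Rightarrow> 'e \<Rightarrow> 'e) \<Rightarrow> bool" where
  "free_complex n s E \<delta> \<longleftrightarrow>
     (\<forall>j. fg_graded_free s (E j)) \<and>
     (\<forall>j>n. \<forall>d. E j d = {0}) \<and>
     (\<forall>j. graded_hom s (E j) s (E (Suc j)) (\<delta> j)) \<and>
     (\<forall>j. \<forall>x \<in> total s (E j). \<delta> (Suc j) (\<delta> j x) = 0)"

definition cocycles :: "(nat \<Rightarrow> int \<Rightarrow> 'e set) \<Rightarrow> (nat \<Rightarrow> 'e \<Rightarrow> 'e) \<Rightarrow> nat \<Rightarrow> int \<Rightarrow> 'e::ab_group_add set"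
  where "cocycles E \<delta> j d = {x \<in> E j d. \<delta> j x = 0}"

definition coboundaries ::
  "(nat \<Rightarrow> int \<Rightarrow> 'e set) \<Rightarrow> (nat \<Rightarrow> 'e \<Rightarrow> 'e) \<Rightarrow> nat \<Rightarrow> int \<Rightarrow> 'e::ab_group_add set"
  where "coboundaries E \<delta> j d = (case j of 0 \<Rightarrow> {0} | Suc i \<Rightarrow> \<delta> i ` E i d)"

text \<open>The classes of the elements of \<open>X\<close> form a \<open>K\<close>-basis of the quotient space \<open>Z / B\<close>
  (in particular, distinct elements of \<open>X\<close> have distinct classes).\<close>

definition quotient_basis ::
  "(('v::finite, 'k::field) mpoly \<Rightarrow> 'm::ab_group_add \<Rightarrow> 'm) \<Rightarrow> 'm set \<Rightarrow> 'm set \<Rightarrow> 'm set \<Rightarrow> bool"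
  where
  "quotient_basis s Z B X \<longleftrightarrow>
     finite X \<and> X \<subseteq> Z \<and>
     (\<forall>z \<in> Z. \<exists>!a :: 'm \<Rightarrow> 'k.
        (\<forall>x. x \<notin> X \<longrightarrow> a x = 0) \<and> z - (\<Sum>x\<in>X. s (mconst (a x)) x) \<in> B)"

definition quotient_dim ::
  "(('v::finite, 'k::field) mpoly \<Rightarrow> 'm::ab_group_add \<Rightarrow> 'm) \<Rightarrow> 'm set \<Rightarrow> 'm set \<Rightarrow> nat" where
  "quotient_dim s Z B = (THE r. \<exists>X. quotient_basis s Z B X \<and> card X = r)"

text \<open>\<open>\<gamma>\<^sub>j\<^sub>,\<^sub>d(E) = dim\<^sub>K H\<^sup>j(E)\<^sub>d\<close>. It is finite for the complexes considered here, because
  the graded components of finitely generated modules are finite-dimensional.\<close>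

definition cohomology_dim ::
  "(('v::finite, 'k::field) mpoly \<Rightarrow> 'e::ab_group_add \<Rightarrow> 'e) \<Rightarrow>
   (nat \<Rightarrow> int \<Rightarrow> 'e set) \<Rightarrow> (nat \<Rightarrow> 'e \<Rightarrow> 'e) \<Rightarrow> nat \<Rightarrow> int \<Rightarrow> nat" where
  "cohomology_dim s E \<delta> j d = quotient_dim s (cocycles E \<delta> j d) (coboundaries E \<delta> j d)"


text \<open>A free resolution \<open>\<dots> \<rightarrow> F\<^sub>1 \<rightarrow> F\<^sub>0 \<rightarrow> M \<rightarrow> 0\<close> has differentials \<open>\<phi> i : F (Suc i) \<rightarrow> F i\<close> and
  augmentation \<open>\<pi> : F 0 \<rightarrow> M\<close>. No bound on its length is imposed.\<close>

definition free_resolution ::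
  "(('v::finite, 'k::field) mpoly \<Rightarrow> 'f::ab_group_add \<Rightarrow> 'f) \<Rightarrow>
   (nat \<Rightarrow> int \<Rightarrow> 'f set) \<Rightarrow> (nat \<Rightarrow> 'f \<Rightarrow> 'f) \<Rightarrow>
   (('v, 'k) mpoly \<Rightarrow> 'm::ab_group_add \<Rightarrow> 'm) \<Rightarrow> (int \<Rightarrow> 'm set) \<Rightarrow> ('f \<Rightarrow> 'm) \<Rightarrow> bool" where
  "free_resolution s F \<phi> t M \<pi> \<longleftrightarrow>
     (\<forall>i. fg_graded_free s (F i)) \<and>
     (\<forall>i. graded_hom s (F (Suc i)) s (F i) (\<phi> i)) \<and>
     graded_hom s (F 0) t M \<pi> \<and>
     \<pi> ` total s (F 0) = total t M \<and>
     \<phi> 0 ` total s (F 1) = {x \<in> total s (F 0). \<pi> x = 0} \<and>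
     (\<forall>i. \<phi> (Suc i) ` total s (F (Suc (Suc i))) = {x \<in> total s (F (Suc i)). \<phi> i x = 0})"

text \<open>Minimality: the image of \<open>\<phi> i\<close> lies in \<open>\<mm> F\<^sub>i\<close>, where \<open>\<mm>\<close> is the ideal generated by the
  variables.\<close>

definition minimal_free_resolution ::
  "(('v::finite, 'k::field) mpoly \<Rightarrow> 'f::ab_group_add \<Rightarrow> 'f) \<Rightarrow>
   (nat \<Rightarrow> int \<Rightarrow> 'f set) \<Rightarrow> (nat \<Rightarrow> 'f \<Rightarrow> 'f) \<Rightarrow>
   (('v, 'k) mpoly \<Rightarrow> 'm::ab_group_add \<Rightarrow> 'm) \<Rightarrow> (int \<Rightarrow> 'm set) \<Rightarrow> ('f \<Rightarrow> 'm) \<Rightarrow> bool" where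
  "minimal_free_resolution s F \<phi> t M \<pi> \<longleftrightarrow>
     free_resolution s F \<phi> t M \<pi> \<and>
     (\<forall>i. \<phi> i ` total s (F (Suc i)) \<subseteq>
            module.span s {s (mvar v) x | v x. x \<in> total s (F i)})"

text \<open>\<open>F\<^sub>i \<cong> \<Oplus>\<^sub>k S(-k)\<^bsup>\<beta> i k\<^esup>\<close>, i.e. \<open>F\<^sub>i\<close> has a homogeneous basis with \<open>\<beta> i k\<close> elements of
  degree \<open>k\<close>.\<close>

definition betti_diagram ::
  "(('v::finite, 'k::field) mpoly \<Rightarrow> 'f::ab_group_add \<Rightarrow> 'f) \<Rightarrow>
   (nat \<Rightarrow> int \<Rightarrow> 'f set) \<Rightarrow> (nat \<Rightarrow> int \<Rightarrow> nat) \<Rightarrow> bool" where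
  "betti_diagram s F \<beta> \<longleftrightarrow>
     (\<forall>i. \<exists>B. finite B \<and> homogeneous_basis s (F i) B \<and> (\<forall>k. \<beta> i k = card (B \<inter> F i k)))"

text \<open>The pairing \<open>\<langle>\<beta>,E\<rangle>\<^sub>c\<^sub>,\<^sub>\<tau>\<close>, as a function of \<open>\<beta>\<close> and \<open>\<gamma> = \<gamma>(E)\<close>. Both sums have only
  finitely many nonzero terms when \<open>\<beta>\<close> comes from a minimal free resolution of a finitely
  generated module and \<open>\<gamma>\<close> from a complex of finitely generated modules: \<open>\<beta> i k = 0\<close> unless
  \<open>k \<ge> i + const\<close>, and \<open>\<gamma> j (-k) = 0\<close> for large \<open>k\<close>. The condition \<open>j \<le> i - 2\<close> is written
  without truncated subtraction.\<close>

definition pairing :: "(nat \<Rightarrow> int \<Rightarrow> nat) \<Rightarrow> (nat \<Rightarrow> int \<Rightarrow> nat) \<Rightarrow> int \<Rightarrow> nat \<Rightarrow> int" where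
  "pairing \<beta> \<gamma> c \<tau> =
     Sum_any (\<lambda>(i, j, k).
       ((-1) ^ (i - j) * int (\<beta> i k) * int (\<gamma> j (- k)))
         when (j \<le> i \<and> (j < \<tau> \<or> j + 2 \<le> i))) +
     Sum_any (\<lambda>(i, j, k, \<epsilon>).
       ((-1) ^ (i - j) * int (\<beta> i k) * int (\<gamma> j (- k)))
         when (\<epsilon> \<le> 1 \<and> j = \<tau> \<and> i = j + \<epsilon> \<and> k \<le> c + int \<epsilon>))"

end

theory Submission
  imports Defs HOL.Vector_Spaces "HOL-Library.Function_Algebras" "HOL-Library.FuncSet"
begin

text \<open>
  Let \<open>F\<close> be the resolution and \<open>Tot\<close> the total complex of \<open>F \<otimes> E\<close> in internal degree \<open>0\<close>, with the
  summands \<open>(F\<^sub>i \<otimes> E\<^sup>j)\<^sub>0\<close>, \<open>i - j = p\<close>, in homological degree \<open>p\<close>. Two facts about it meet in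
  the proof. As the \<open>E\<^sup>j\<close> are free and \<open>F\<close> is exact in positive degrees, \<open>Tot\<close> is exact in degrees
  \<open>p \<ge> 1\<close> (\<open>dTot_exact\<close>). As the \<open>F\<^sub>i\<close> are free, the cohomology of \<open>(F\<^sub>i \<otimes> E)\<^sub>0\<close> at \<open>j\<close> is
  \<open>(F\<^sub>i \<otimes> H\<^sup>j(E))\<^sub>0\<close>, of dimension \<open>\<Sum>\<^sub>k \<beta>\<^sub>i\<^sub>,\<^sub>k \<gamma>\<^sub>j\<^sub>,\<^sub>-\<^sub>k\<close>. The pairing is therefore an alternating sum
  of dimensions of spaces \<open>(F\<^sub>i \<otimes> H\<^sup>j(E))\<^sub>0\<close>: all of them for \<open>p \<ge> 2\<close>, and for \<open>p = 0, 1\<close> those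
  with \<open>j < \<tau>\<close> and, for \<open>j = \<tau>\<close>, the part that belongs to generators of \<open>F\<^sub>i\<close> of degree at most
  \<open>c + p\<close>.

  Choose splittings \<open>E\<^sup>j\<^sub>d = H \<oplus> B \<oplus> C\<close> over \<open>K\<close>, where \<open>B\<close> are the coboundaries and \<open>B \<oplus> H\<close> the
  cocycles, so that \<open>\<delta>\<close> maps \<open>C\<close> in position \<open>j\<close> isomorphically to \<open>B\<close> in position \<open>j + 1\<close>; write \<open>H\<^sub>p\<close>, \<open>B\<^sub>p\<close>, \<open>C\<^sub>p\<close>
  for the corresponding subspaces of \<open>Tot\<^sub>p\<close>. By exactness the cycles \<open>Z\<^sub>1 \<subseteq> Tot\<^sub>1\<close> have dimension
  \<open>\<Sum>\<^sub>p\<^sub>\<ge>\<^sub>2 (-1)\<^sup>p dim Tot\<^sub>p\<close>, and since \<open>dim B\<^sub>p = dim C\<^sub>p\<^sub>+\<^sub>1\<close> this sum collapses to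
  \<open>\<Sum>\<^sub>p\<^sub>\<ge>\<^sub>2 (-1)\<^sup>p dim H\<^sub>p + dim C\<^sub>2\<close> (\<open>alternating_hsum\<close>). With primes for the truncated spaces,
  the theorem becomes the lower bound \<open>dim Z\<^sub>1 \<ge> dim C\<^sub>2 + dim H'\<^sub>1 - dim H'\<^sub>0\<close>
  (\<open>dimension_inequality\<close>), and it suffices to exhibit enough cycles.

  The differential \<open>D\<close> of \<open>Tot\<close> is injective on \<open>C\<^sub>2\<close>, which gives the cycles \<open>D C\<^sub>2\<close>. Further cycles
  lie in \<open>N = H'\<^sub>1 + C'\<^sub>1\<close>, where \<open>C'\<^sub>1\<close> consists of the summands of \<open>C\<^sub>1\<close> with \<open>j < \<tau>\<close>. The
  differential never raises \<open>j\<close> on \<open>H'\<^sub>1\<close>, and it raises \<open>j\<close> by at most one on \<open>C'\<^sub>1\<close>, with the raised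
  part in \<open>B\<close>; by minimality a generator of degree at most \<open>c + 1\<close> goes to generators of degree at
  most \<open>c\<close>. So \<open>D N \<subseteq> H'\<^sub>0 + B'\<^sub>0 + C\<^sub>0\<close> with \<open>dim B'\<^sub>0 = dim C'\<^sub>1\<close>, and a boundary in \<open>C\<^sub>0\<close> vanishes.
  Hence \<open>D\<close> has rank at most \<open>dim H'\<^sub>0 + dim C'\<^sub>1\<close> on \<open>N\<close>, and its kernel there has dimension at
  least \<open>dim H'\<^sub>1 - dim H'\<^sub>0\<close>. This kernel meets \<open>D C\<^sub>2\<close> trivially.

  Minimality has a second use: it makes the degrees of the generators of \<open>F\<^sub>i\<close> grow with \<open>i\<close>, so that
  \<open>Tot\<^sub>p = 0\<close> for large \<open>p\<close> and all sums are finite.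
\<close>

section \<open>Finite-dimensional subspaces of arbitrary vector spaces\<close>

text \<open>The differentials of a complex are maps of the ambient type that are linear only on the modules
  in question, so linearity is relative to a subspace.\<close>

definition linear_on :: "('k \<Rightarrow> 'a \<Rightarrow> 'a) \<Rightarrow> ('k \<Rightarrow> 'b \<Rightarrow> 'b) \<Rightarrow> 'a set \<Rightarrow> ('a::plus \<Rightarrow> 'b::plus) \<Rightarrow> bool"
  where "linear_on s t V f \<longleftrightarrow>
    (\<forall>x\<in>V. \<forall>y\<in>V. f (x + y) = f x + f y) \<and> (\<forall>a. \<forall>x\<in>V. f (s a x) = t a (f x))"

lemma linear_onI:
  assumes "\<And>x y. x \<in> V \<Longrightarrow> y \<in> V \<Longrightarrow> f (x + y) = f x + f y"
    and "\<And>a x. x \<in> V \<Longrightarrow> f (s a x) = t a (f x)"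
  shows "linear_on s t V f"
  unfolding linear_on_def using assms by blast

lemma linear_on_add: "linear_on s t V f \<Longrightarrow> x \<in> V \<Longrightarrow> y \<in> V \<Longrightarrow> f (x + y) = f x + f y"
  and linear_on_scale: "linear_on s t V f \<Longrightarrow> x \<in> V \<Longrightarrow> f (s a x) = t a (f x)"
  by (simp_all add: linear_on_def)

lemma linear_on_subset:
  assumes "linear_on s t V f" "U \<subseteq> V" shows "linear_on s t U f"
proof (rule linear_onI)
  fix x y assume "x \<in> U" "y \<in> U"
  with assms(2) show "f (x + y) = f x + f y" by (intro linear_on_add[OF assms(1)]) auto
next
  fix a x assume "x \<in> U"
  with assms(2) show "f (s a x) = t a (f x)" by (intro linear_on_scale[OF assms(1)]) auto
qed

context vector_space
begin

text \<open>The ambient space need not be finite-dimensional, so finiteness is a property of the subspace; it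
  also excludes that \<^const>\<open>vector_space.dim\<close> is the cardinality \<open>0\<close> of an infinite basis.\<close>

definition fin_dim :: "'b set \<Rightarrow> bool"
  where "fin_dim V \<longleftrightarrow> (\<exists>S. finite S \<and> V \<subseteq> span S)"

lemma fin_dim_subset: "fin_dim V \<Longrightarrow> U \<subseteq> V \<Longrightarrow> fin_dim U"
  unfolding fin_dim_def by blast

lemma fin_dim_singleton: "fin_dim {0}"
  unfolding fin_dim_def by (rule exI[of _ "{}"]) simp

lemma fin_dim_independent_finite:
  assumes "fin_dim V" "independent A" "A \<subseteq> V" shows "finite A"
  using assms independent_span_bound unfolding fin_dim_def by (meson subset_trans)

lemma dim_mono_fin_dim:
  assumes "subspace U" "fin_dim V" "U \<subseteq> V"
  shows "dim U \<le> dim V"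
proof -
  obtain A where A: "A \<subseteq> U" "independent A" "U \<subseteq> span A" "card A = dim U"
    by (rule basis_exists[of U])
  obtain C where C: "C \<subseteq> V" "independent C" "V \<subseteq> span C" "card C = dim V"
    by (rule basis_exists[of V])
  have "finite C" using fin_dim_independent_finite C assms(2) by blast
  moreover have "A \<subseteq> span C" using A C assms(3) by blast
  ultimately show ?thesis using independent_span_bound[OF _ A(2)] A(4) C(4) by metis
qed

lemma dim_singleton_0 [simp]: "dim {0} = 0"
  using dim_span_eq_card_independent[OF independent_empty] by simp

text \<open>Take the kernel in \<open>V\<close> of a linear projection onto \<open>U\<close>.\<close>

lemma complement_exists:
  assumes U: "subspace U" and V: "subspace V" and UV: "U \<subseteq> V"
  obtains W where "subspace W" "W \<subseteq> V" "U \<inter> W = {0}" "\<And>v. v \<in> V \<Longrightarrow> \<exists>u\<in>U. \<exists>w\<in>W. v = u + w"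
proof -
  interpret p: vector_space_pair scale scale by unfold_locales
  have "Vector_Spaces.linear scale scale (\<lambda>x. x)" by (simp add: Vector_Spaces.linear_iff vector_space_axioms scale_right_distrib)
  from p.linear_exists_left_inverse_on[OF this U]
  obtain g where gU: "g ` UNIV \<subseteq> U" and g: "Vector_Spaces.linear scale scale g" and gid: "\<And>v. v \<in> U \<Longrightarrow> g v = v"
    by (auto simp: inj_on_def)
  interpret g: Vector_Spaces.linear scale scale g by (fact g)
  show thesis
  proof (rule that[of "V \<inter> {x. g x = 0}"])
    show "subspace (V \<inter> {x. g x = 0})" using V g.subspace_kernel subspace_inter by blast
    show "V \<inter> {x. g x = 0} \<subseteq> V" by blast
    show "U \<inter> (V \<inter> {x. g x = 0}) = {0}"
      using gid subspace_0[OF U] subspace_0[OF V] by auto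
    show "\<exists>u\<in>U. \<exists>w\<in>V \<inter> {x. g x = 0}. v = u + w" if "v \<in> V" for v
    proof (intro bexI)
      show "v = g v + (v - g v)" by simp
      show "g v \<in> U" using gU by blast
      then show "v - g v \<in> V \<inter> {x. g x = 0}"
        using that UV V gid by (auto simp: subspace_diff g.diff)
    qed
  qed
qed

end

context vector_space_pair
begin

text \<open>Prescribing the values of \<open>f\<close> on a basis of \<open>V\<close> gives a map that is linear everywhere; this
  brings relative linearity back to the usual one.\<close>

lemma linear_on_extend:
  assumes V: "vs1.subspace V" and f: "linear_on s1 s2 V f"
  obtains g where "Vector_Spaces.linear s1 s2 g" "\<And>x. x \<in> V \<Longrightarrow> g x = f x"
proof -
  obtain A where A: "A \<subseteq> V" "vs1.independent A" "V \<subseteq> vs1.span A" "card A = vs1.dim V"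
    by (rule vs1.basis_exists[of V])
  obtain g where g: "Vector_Spaces.linear s1 s2 g" "\<forall>x\<in>A. g x = f x"
    using linear_independent_extend[OF A(2), of f] by blast
  interpret g: Vector_Spaces.linear s1 s2 g by fact
  note fadd = linear_on_add[OF f] and fsc = linear_on_scale[OF f]
  have f0: "f 0 = 0" using fsc[OF vs1.subspace_0[OF V], of 0] by simp
  have "vs1.subspace {x \<in> V. g x = f x}"
  proof (rule vs1.subspaceI)
    show "0 \<in> {x \<in> V. g x = f x}" using vs1.subspace_0[OF V] f0 g.zero by simp
  next
    fix x y assume xy: "x \<in> {x \<in> V. g x = f x}" "y \<in> {x \<in> V. g x = f x}"
    then have "x + y \<in> V" using vs1.subspace_add[OF V] by blast
    with xy show "x + y \<in> {x \<in> V. g x = f x}" using fadd[of x y] g.add[of x y] by simp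
  next
    fix a x assume x: "x \<in> {x \<in> V. g x = f x}"
    then have "s1 a x \<in> V" using vs1.subspace_scale[OF V] by blast
    with x show "s1 a x \<in> {x \<in> V. g x = f x}" using fsc[of x a] g.scale[of a x] by simp
  qed
  moreover have "A \<subseteq> {x \<in> V. g x = f x}" using A g by blast
  ultimately have "vs1.span A \<subseteq> {x \<in> V. g x = f x}" by (rule vs1.span_minimal[rotated])
  with A(3) g(1) that show thesis by blast
qed

text \<open>A basis of the kernel, extended to a basis of \<open>V\<close>: the images of the added vectors are a basis of
  the image, because the span of the added vectors meets the kernel trivially.\<close>

lemma rank_nullity:
  assumes V: "vs1.subspace V" and fd: "vs1.fin_dim V" and f: "linear_on s1 s2 V f"
  shows "vs1.dim V = vs1.dim {x \<in> V. f x = 0} + vs2.dim (f ` V)"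
    and "vs1.subspace {x \<in> V. f x = 0}"
    and "vs2.subspace (f ` V)" and "vs2.fin_dim (f ` V)"
proof -
  obtain g where g: "Vector_Spaces.linear s1 s2 g" and gf: "\<And>x. x \<in> V \<Longrightarrow> g x = f x"
    using linear_on_extend[OF V f] by blast
  interpret g: Vector_Spaces.linear s1 s2 g by fact
  let ?K = "{x \<in> V. g x = 0}"
  have K: "{x \<in> V. f x = 0} = ?K" using gf by auto
  have im: "f ` V = g ` V" using gf by force
  have "?K = V \<inter> {x. g x = 0}" by blast
  then have subK: "vs1.subspace ?K" using V g.subspace_kernel vs1.subspace_inter by simp
  then show "vs1.subspace {x \<in> V. f x = 0}" using K by simp
  show "vs2.subspace (f ` V)" using im g.subspace_image[OF V] by simp
  show "vs2.fin_dim (f ` V)"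
    using fd im g.spans_image unfolding vs1.fin_dim_def vs2.fin_dim_def by (metis finite_imageI)
  obtain A where A: "A \<subseteq> ?K" "vs1.independent A" "?K \<subseteq> vs1.span A" "card A = vs1.dim ?K"
    by (rule vs1.basis_exists[of ?K])
  obtain S where S: "A \<subseteq> S" "S \<subseteq> V" "vs1.independent S" "V \<subseteq> vs1.span S"
    using vs1.maximal_independent_subset_extend[OF _ A(2), of V] A(1) by blast
  let ?C = "S - A"
  have finS: "finite S" using vs1.fin_dim_independent_finite[OF fd S(3,2)] .
  have indC: "vs1.independent ?C" using S(3) vs1.independent_mono by blast
  have spS: "vs1.span S = V" using S V by (metis vs1.span_subspace)
  have spA: "vs1.span A = ?K" using A subK by (metis vs1.span_subspace)
  \<comment> \<open>a linear map that is the identity on the kernel and vanishes on the added basis vectors\<close>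
  obtain q where q: "Vector_Spaces.linear s1 s1 q" "\<forall>x\<in>S. q x = (if x \<in> A then x else 0)"
  proof -
    interpret p: vector_space_pair s1 s1 by unfold_locales
    show thesis
      using p.linear_independent_extend[OF S(3), of "\<lambda>x. if x \<in> A then x else 0"] that by blast
  qed
  interpret q: Vector_Spaces.linear s1 s1 q by fact
  have qA: "q x = x" if "x \<in> vs1.span A" for x
  proof -
    have "vs1.span A \<subseteq> {x. q x = x}"
      using q S(1) by (intro vs1.span_minimal vs1.subspaceI) (auto simp: q.add q.scale)
    with that show ?thesis by blast
  qed
  have qC: "q x = 0" if "x \<in> vs1.span ?C" for x
  proof -
    have "vs1.span ?C \<subseteq> {x. q x = 0}"
      using q by (intro vs1.span_minimal q.subspace_kernel) auto
    with that show ?thesis by blast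
  qed
  have inj: "inj_on g (vs1.span ?C)"
  proof (subst g.inj_on_iff_eq_0)
    show "vs1.subspace (vs1.span ?C)" by simp
    show "\<forall>x\<in>vs1.span ?C. g x = 0 \<longrightarrow> x = 0"
    proof (intro ballI impI)
      fix x assume x: "x \<in> vs1.span ?C" "g x = 0"
      then have "x \<in> V" using spS vs1.span_mono[of ?C S] by blast
      then have "x \<in> vs1.span A" using x spA by blast
      then show "x = 0" using qA qC x by metis
    qed
  qed
  have "vs2.independent (g ` ?C)" using g.independent_injective_image[OF indC inj] .
  moreover have "vs2.span (g ` ?C) = g ` V"
  proof -
    have "g ` V \<subseteq> vs2.span (g ` ?C)"
    proof
      fix y assume "y \<in> g ` V"
      then obtain x where x: "x \<in> vs1.span S" "y = g x" using spS by auto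
      then have "x \<in> vs1.span (A \<union> ?C)" using S(1) by (simp add: Un_absorb1)
      then obtain a b where "x = a + b" "a \<in> vs1.span A" "b \<in> vs1.span ?C"
        unfolding vs1.span_Un by blast
      then show "y \<in> vs2.span (g ` ?C)" using x spA by (auto simp: g.add g.span_image)
    qed
    moreover have "vs2.span (g ` ?C) \<subseteq> g ` V"
      unfolding g.span_image using spS vs1.span_mono[of ?C S] by blast
    ultimately show ?thesis by blast
  qed
  moreover have "card (g ` ?C) = card ?C"
    using inj vs1.span_superset by (metis card_image inj_on_subset)
  ultimately have "vs2.dim (g ` V) = card ?C" using vs2.dim_span_eq_card_independent by metis
  moreover have "vs1.dim V = card S" using spS S(3) vs1.dim_span_eq_card_independent by metis
  moreover have "card S = card A + card ?C"
    using card_Un_disjoint[of A ?C] finS S(1) by (simp add: Un_absorb1 finite_subset)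
  ultimately show "vs1.dim V = vs1.dim {x \<in> V. f x = 0} + vs2.dim (f ` V)"
    using A(4) K im by simp
qed

lemma dim_image_injective:
  assumes V: "vs1.subspace V" and fd: "vs1.fin_dim V" and f: "linear_on s1 s2 V f"
    and inj: "\<And>x. x \<in> V \<Longrightarrow> f x = 0 \<Longrightarrow> x = 0"
  shows "vs2.dim (f ` V) = vs1.dim V"
proof -
  have "f 0 = 0" using linear_on_scale[OF f vs1.subspace_0[OF V], of 0] by simp
  then have "{x \<in> V. f x = 0} = {0}" using inj vs1.subspace_0[OF V] by auto
  then show ?thesis using rank_nullity(1)[OF V fd f] by simp
qed

end

text \<open>Direct sums are modelled by spaces of functions into one ambient space, with a prescribed subspace
  for each coordinate.\<close>

definition fun_scale :: "('k \<Rightarrow> 'e \<Rightarrow> 'e) \<Rightarrow> 'k \<Rightarrow> ('i \<Rightarrow> 'e) \<Rightarrow> 'i \<Rightarrow> 'e"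
  where "fun_scale s a x = (\<lambda>i. s a (x i))"

lemma fun_scale_apply: "fun_scale s a x i = s a (x i)"
  by (simp add: fun_scale_def)

lemma vector_space_fun_scale:
  assumes "vector_space s" shows "vector_space (fun_scale s)"
proof -
  interpret vector_space s by fact
  show ?thesis
    by unfold_locales (auto simp: fun_scale_apply fun_eq_iff scale_right_distrib scale_left_distrib)
qed

definition box :: "'i set \<Rightarrow> ('i \<Rightarrow> 'e::zero set) \<Rightarrow> ('i \<Rightarrow> 'e) set"
  where "box I X = {x. \<forall>i. if i \<in> I then x i \<in> X i else x i = 0}"

lemma boxI: "(\<And>i. i \<in> I \<Longrightarrow> x i \<in> X i) \<Longrightarrow> (\<And>i. i \<notin> I \<Longrightarrow> x i = 0) \<Longrightarrow> x \<in> box I X"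
  by (simp add: box_def)

lemma boxD: "x \<in> box I X \<Longrightarrow> i \<in> I \<Longrightarrow> x i \<in> X i" "x \<in> box I X \<Longrightarrow> i \<notin> I \<Longrightarrow> x i = 0"
  by (simp_all add: box_def split: if_splits)

lemma box_mono: "(\<And>i. i \<in> I \<Longrightarrow> X i \<subseteq> Y i) \<Longrightarrow> box I X \<subseteq> box I Y"
  unfolding box_def by (auto split: if_splits)

context vector_space
begin

abbreviation fn_scale :: "'a \<Rightarrow> ('i \<Rightarrow> 'b) \<Rightarrow> 'i \<Rightarrow> 'b"
  where "fn_scale \<equiv> fun_scale scale"

abbreviation sum_space :: "'b set \<Rightarrow> 'b set \<Rightarrow> 'b set"
  where "sum_space U W \<equiv> {x + y | x y. x \<in> U \<and> y \<in> W}"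

lemma box_subspace:
  assumes "\<And>i. i \<in> I \<Longrightarrow> subspace (X i)"
  shows "module.subspace fn_scale (box I X)"
proof -
  interpret fn: vector_space "fn_scale :: 'a \<Rightarrow> ('i \<Rightarrow> 'b) \<Rightarrow> 'i \<Rightarrow> 'b"
    by (rule vector_space_fun_scale) unfold_locales
  show ?thesis
    by (intro fn.subspaceI boxI)
      (auto simp: fun_scale_apply boxD(2) dest: boxD(1) intro: assms subspace_0 subspace_add subspace_scale)
qed

lemma box_fin_dim:
  fixes X :: "'i \<Rightarrow> 'b set"
  assumes fin: "finite I" and fd: "\<And>i. i \<in> I \<Longrightarrow> fin_dim (X i)"
  shows "vector_space.fin_dim fn_scale (box I X)"
proof -
  interpret fn: vector_space "fn_scale :: 'a \<Rightarrow> ('i \<Rightarrow> 'b) \<Rightarrow> 'i \<Rightarrow> 'b"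
    by (rule vector_space_fun_scale) unfold_locales
  define single :: "'i \<Rightarrow> 'b \<Rightarrow> 'i \<Rightarrow> 'b" where "single i v = (\<lambda>k. if k = i then v else 0)" for i v
  have lin: "Vector_Spaces.linear scale fn_scale (single i)" for i
    by (auto simp: Vector_Spaces.linear_iff single_def fun_eq_iff fun_scale_apply scale_right_distrib
        vector_space_axioms fn.vector_space_axioms)
  have "\<forall>i\<in>I. \<exists>S. finite S \<and> X i \<subseteq> span S" using fd unfolding fin_dim_def by blast
  then obtain S where S: "\<And>i. i \<in> I \<Longrightarrow> finite (S i)" "\<And>i. i \<in> I \<Longrightarrow> X i \<subseteq> span (S i)"
    by metis
  let ?T = "\<Union>i\<in>I. single i ` S i"
  have "box I X \<subseteq> fn.span ?T"
  proof
    fix x assume x: "x \<in> box I X"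
    have "single i (x i) \<in> fn.span ?T" if "i \<in> I" for i
    proof -
      interpret l: Vector_Spaces.linear scale fn_scale "single i" by (rule lin)
      have "x i \<in> span (S i)" using boxD(1)[OF x that] S(2)[OF that] by (rule rev_subsetD)
      then have "single i (x i) \<in> single i ` span (S i)" by (rule imageI)
      also have "\<dots> = fn.span (single i ` S i)" by (rule l.span_image[symmetric])
      also have "\<dots> \<subseteq> fn.span ?T" using that by (intro fn.span_mono) blast
      finally show ?thesis .
    qed
    then have "(\<Sum>i\<in>I. single i (x i)) \<in> fn.span ?T" by (rule fn.span_sum)
    moreover have "(\<Sum>i\<in>I. single i (x i)) = x"
    proof
      fix k
      have "(\<Sum>i\<in>J. single i (x i)) k = (\<Sum>i\<in>J. single i (x i) k)" if "finite J" for J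
        using that by (induction J) auto
      then have "(\<Sum>i\<in>I. single i (x i)) k = (\<Sum>i\<in>I. if k = i then x i else 0)"
        using fin by (simp add: single_def)
      also have "\<dots> = x k" using x fin boxD(2)[OF x, of k] by simp
      finally show "(\<Sum>i\<in>I. single i (x i)) k = x k" .
    qed
    ultimately show "x \<in> fn.span ?T" by simp
  qed
  moreover have "finite ?T" using fin S(1) by blast
  ultimately show ?thesis unfolding fn.fin_dim_def by blast
qed

text \<open>Induction on the index set: evaluation at the new index maps the box onto the new factor, and its
  kernel is the box over the remaining indices.\<close>

lemma dim_box:
  fixes X :: "'i \<Rightarrow> 'b set"
  assumes "finite I" and "\<And>i. i \<in> I \<Longrightarrow> subspace (X i)" and "\<And>i. i \<in> I \<Longrightarrow> fin_dim (X i)"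
  shows "vector_space.dim fn_scale (box I X) = (\<Sum>i\<in>I. dim (X i))"
  using assms
proof (induction I)
  case empty
  interpret fn: vector_space "fn_scale :: 'a \<Rightarrow> ('i \<Rightarrow> 'b) \<Rightarrow> 'i \<Rightarrow> 'b"
    by (rule vector_space_fun_scale) unfold_locales
  have "box {} X = {0}" by (auto simp: box_def fun_eq_iff)
  then show ?case by simp
next
  case (insert k I)
  interpret fn: vector_space "fn_scale :: 'a \<Rightarrow> ('i \<Rightarrow> 'b) \<Rightarrow> 'i \<Rightarrow> 'b"
    by (rule vector_space_fun_scale) unfold_locales
  interpret p: vector_space_pair "fn_scale :: 'a \<Rightarrow> ('i \<Rightarrow> 'b) \<Rightarrow> 'i \<Rightarrow> 'b" scale by unfold_locales
  let ?V = "box (insert k I) X"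
  have sub: "fn.subspace ?V" using insert.prems(1) by (rule box_subspace)
  have fd: "fn.fin_dim ?V" using insert.hyps(1) insert.prems(2) by (intro box_fin_dim) auto
  have lin: "linear_on fn_scale scale ?V (\<lambda>x. x k)" by (intro linear_onI) (auto simp: fun_scale_apply)
  have "{x \<in> ?V. x k = 0} = box I X"
    using insert.hyps(2) subspace_0[OF insert.prems(1), of k]
    by (auto simp: box_def split: if_splits)
  moreover have "(\<lambda>x. x k) ` ?V = X k"
  proof
    show "X k \<subseteq> (\<lambda>x. x k) ` ?V"
    proof
      fix v assume "v \<in> X k"
      then have "(\<lambda>i. if i = k then v else 0) \<in> ?V"
        using insert.prems(1) by (intro boxI) (auto intro: subspace_0)
      then show "v \<in> (\<lambda>x. x k) ` ?V" by (rule rev_image_eqI) simp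
    qed
    show "(\<lambda>x. x k) ` ?V \<subseteq> X k" by (rule image_subsetI) (simp add: box_def)
  qed
  ultimately show ?case
    using p.rank_nullity(1)[OF sub fd lin] insert by simp
qed

text \<open>If \<open>U \<inter> W = 0\<close>, addition is injective on the external sum \<open>U \<times> W\<close>, which is the box over the
  index type \<^typ>\<open>bool\<close>.\<close>

lemma dim_sum_space:
  assumes U: "subspace U" "fin_dim U" and W: "subspace W" "fin_dim W" and UW: "U \<inter> W \<subseteq> {0}"
  shows "dim (sum_space U W) = dim U + dim W" and "fin_dim (sum_space U W)"
proof -
  interpret fn: vector_space "fn_scale :: 'a \<Rightarrow> (bool \<Rightarrow> 'b) \<Rightarrow> bool \<Rightarrow> 'b"
    by (rule vector_space_fun_scale) unfold_locales
  interpret p: vector_space_pair "fn_scale :: 'a \<Rightarrow> (bool \<Rightarrow> 'b) \<Rightarrow> bool \<Rightarrow> 'b" scale by unfold_locales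
  let ?X = "\<lambda>b. if b then U else W"
  let ?V = "box UNIV ?X"
  let ?f = "\<lambda>x :: bool \<Rightarrow> 'b. x True + x False"
  have sub: "fn.subspace ?V" using U W by (intro box_subspace) simp
  have fd: "fn.fin_dim ?V" using U W by (intro box_fin_dim) simp_all
  have lin: "linear_on fn_scale scale ?V ?f"
    by (intro linear_onI) (auto simp: fun_scale_apply scale_right_distrib)
  have im: "?f ` ?V = sum_space U W"
  proof
    show "sum_space U W \<subseteq> ?f ` ?V"
    proof
      fix z assume "z \<in> sum_space U W"
      then obtain x y where z: "z = x + y" and "x \<in> U" "y \<in> W" by blast
      then have "(\<lambda>b. if b then x else y) \<in> ?V" by (auto simp: box_def)
      then show "z \<in> ?f ` ?V" by (rule rev_image_eqI) (simp add: z)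
    qed
  qed (auto simp: box_def)
  have inj: "x = 0" if x: "x \<in> ?V" "?f x = 0" for x
  proof -
    have *: "x True \<in> U" "x False \<in> W" using boxD(1)[OF x(1), of True] boxD(1)[OF x(1), of False] by simp_all
    moreover have "x True = - x False" using x(2) by (simp add: eq_neg_iff_add_eq_0)
    ultimately have "x True \<in> U \<inter> W" using subspace_neg[OF W(1)] by simp
    then have "x True = 0" "x False = 0" using UW x(2) by auto
    then have "x b = 0" for b by (cases b) simp_all
    then show ?thesis by (simp add: fun_eq_iff)
  qed
  have "dim (sum_space U W) = fn.dim ?V"
    using p.dim_image_injective[OF sub fd lin inj] im by simp
  also have "\<dots> = (\<Sum>b\<in>UNIV. dim (?X b))" using U W by (intro dim_box) simp_all
  finally show "dim (sum_space U W) = dim U + dim W" by (simp add: UNIV_bool)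
  show "fin_dim (sum_space U W)" using p.rank_nullity(4)[OF sub fd lin] im by simp
qed

lemma dim_independent_subspaces_le:
  assumes "subspace U" "subspace W" "subspace V" "fin_dim V" "U \<subseteq> V" "W \<subseteq> V" "U \<inter> W \<subseteq> {0}"
  shows "dim U + dim W \<le> dim V"
proof -
  have "sum_space U W \<subseteq> V" using assms by (auto intro: subspace_add)
  moreover have "dim (sum_space U W) = dim U + dim W"
    using assms by (intro dim_sum_space) (auto intro: fin_dim_subset)
  ultimately show ?thesis
    using dim_mono_fin_dim[OF subspace_sums[OF assms(1,2)] assms(4)] by simp
qed

definition is_complement :: "'b set \<Rightarrow> 'b set \<Rightarrow> 'b set \<Rightarrow> bool"
  where "is_complement U X W \<longleftrightarrow>
    subspace W \<and> W \<subseteq> X \<and> U \<inter> W = {0} \<and> (\<forall>v\<in>X. \<exists>u\<in>U. \<exists>w\<in>W. v = u + w)"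

lemma is_complement_exists:
  assumes "subspace U" "subspace X" "U \<subseteq> X" shows "\<exists>W. is_complement U X W"
proof (rule complement_exists[OF assms])
  fix W assume "subspace W" "W \<subseteq> X" "U \<inter> W = {0}" "\<And>v. v \<in> X \<Longrightarrow> \<exists>u\<in>U. \<exists>w\<in>W. v = u + w"
  then have "is_complement U X W" by (simp add: is_complement_def)
  then show ?thesis ..
qed

lemma dim_is_complement:
  assumes "is_complement U X W" "subspace U" "subspace X" "fin_dim X" "U \<subseteq> X"
  shows "dim X = dim U + dim W"
proof -
  have W: "subspace W" "W \<subseteq> X" "U \<inter> W = {0}" "\<forall>v\<in>X. \<exists>u\<in>U. \<exists>w\<in>W. v = u + w"
    using assms(1) by (simp_all add: is_complement_def)
  have "sum_space U W = X"
  proof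
    show "sum_space U W \<subseteq> X" using W(2) assms(3,5) by (auto intro: subspace_add)
    show "X \<subseteq> sum_space U W" using W(4) by blast
  qed
  moreover have "dim (sum_space U W) = dim U + dim W"
    using W assms fin_dim_subset[OF assms(4)] by (intro dim_sum_space) simp_all
  ultimately show ?thesis by simp
qed

end

section \<open>The truncated Euler characteristic of a double complex\<close>

text \<open>The linear algebra of the proof, without reference to the polynomial ring. \<open>B i\<close> stands for a
  homogeneous basis of \<open>F\<^sub>i\<close>, with degrees \<open>dg i\<close>. An element of \<open>(F\<^sub>i \<otimes> E\<^sup>j)\<^sub>0\<close> is written
  as \<open>\<Sum>\<^sub>e e \<otimes> u e\<close> and identified with the function \<open>u\<close>; as the total degree is \<open>0\<close>, the coefficient
  \<open>u e\<close> has degree \<open>- dg i e\<close>. The map \<open>\<Phi> i\<close> is induced by the differential from \<open>F\<^sub>i\<^sub>+\<^sub>1\<close> to \<open>F\<^sub>i\<close>, and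
  \<open>\<delta>\<close> acts on the coefficients. The last assumption is what remains of minimality.\<close>

locale graded_double_complex = vector_space scale
  for scale :: "'k::field \<Rightarrow> 'e::ab_group_add \<Rightarrow> 'e" +
  fixes E :: "nat \<Rightarrow> int \<Rightarrow> 'e set" and \<delta> :: "nat \<Rightarrow> 'e \<Rightarrow> 'e" and n :: nat
    and B :: "nat \<Rightarrow> 'i set" and dg :: "nat \<Rightarrow> 'i \<Rightarrow> int"
    and \<Phi> :: "nat \<Rightarrow> ('i \<Rightarrow> 'e) \<Rightarrow> 'i \<Rightarrow> 'e"
    and cell :: "nat \<Rightarrow> nat \<Rightarrow> ('i \<Rightarrow> 'e) set"
  defines "cell i j \<equiv> box (B i) (\<lambda>e. E j (- dg i e))"
  assumes subspace_E: "subspace (E j d)"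
    and fin_dim_E: "fin_dim (E j d)"
    and E_beyond: "n < j \<Longrightarrow> E j d = {0}"
    and \<delta>_linear: "linear_on scale scale (E j d) (\<delta> j)"
    and \<delta>_in: "x \<in> E j d \<Longrightarrow> \<delta> j x \<in> E (Suc j) d"
    and \<delta>_\<delta>: "x \<in> E j d \<Longrightarrow> \<delta> (Suc j) (\<delta> j x) = 0"
    and finite_B: "finite (B i)"
    and \<Phi>_linear: "linear_on (fun_scale scale) (fun_scale scale) (cell (Suc i) j) (\<Phi> i)"
    and \<Phi>_in: "u \<in> cell (Suc i) j \<Longrightarrow> \<Phi> i u \<in> cell i j"
    and \<Phi>_\<Phi>: "u \<in> cell (Suc (Suc i)) j \<Longrightarrow> \<Phi> i (\<Phi> (Suc i) u) = 0"
    and \<Phi>_exact: "u \<in> cell (Suc i) j \<Longrightarrow> \<Phi> i u = 0 \<Longrightarrow> \<exists>w\<in>cell (Suc (Suc i)) j. \<Phi> (Suc i) w = u"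
    and \<Phi>_\<delta>: "u \<in> cell (Suc i) j \<Longrightarrow> \<Phi> i (\<delta> j \<circ> u) = \<delta> j \<circ> \<Phi> i u"
    and \<Phi>_degree: "u \<in> cell (Suc i) j \<Longrightarrow> \<Phi> i u e \<noteq> 0 \<Longrightarrow>
          \<exists>e'\<in>B (Suc i). u e' \<noteq> 0 \<and> dg i e < dg (Suc i) e'"
begin

sublocale fn: vector_space "fun_scale scale :: 'k \<Rightarrow> ('i \<Rightarrow> 'e) \<Rightarrow> 'i \<Rightarrow> 'e"
  by (rule vector_space_fun_scale) unfold_locales

sublocale fn2: vector_space "fun_scale (fun_scale scale) :: 'k \<Rightarrow> (nat \<Rightarrow> 'i \<Rightarrow> 'e) \<Rightarrow> nat \<Rightarrow> 'i \<Rightarrow> 'e"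
  by (rule vector_space_fun_scale) unfold_locales

lemma zero_E: "0 \<in> E j d" using subspace_0[OF subspace_E] .
lemma add_E: "x \<in> E j d \<Longrightarrow> y \<in> E j d \<Longrightarrow> x + y \<in> E j d" using subspace_add[OF subspace_E] .
lemma neg_E: "x \<in> E j d \<Longrightarrow> - x \<in> E j d" using subspace_neg[OF subspace_E] .

lemma \<delta>_add: "x \<in> E j d \<Longrightarrow> y \<in> E j d \<Longrightarrow> \<delta> j (x + y) = \<delta> j x + \<delta> j y"
  by (rule linear_on_add[OF \<delta>_linear])

lemma \<delta>_scale: "x \<in> E j d \<Longrightarrow> \<delta> j (scale a x) = scale a (\<delta> j x)"
  by (rule linear_on_scale[OF \<delta>_linear])

lemma \<delta>_0 [simp]: "\<delta> j 0 = 0"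
  using \<delta>_scale[OF zero_E, of j 0] by simp

lemma \<delta>_neg: "x \<in> E j d \<Longrightarrow> \<delta> j (- x) = - \<delta> j x"
  using \<delta>_add[of x j d "- x"] neg_E by (simp add: eq_neg_iff_add_eq_0 add.commute)

lemma subspace_cell: "fn.subspace (cell i j)"
  unfolding cell_def by (rule box_subspace) (rule subspace_E)

lemma fin_dim_cell: "fn.fin_dim (cell i j)"
  unfolding cell_def by (rule box_fin_dim[OF finite_B fin_dim_E])

lemma \<Phi>_add: "u \<in> cell (Suc i) j \<Longrightarrow> w \<in> cell (Suc i) j \<Longrightarrow> \<Phi> i (u + w) = \<Phi> i u + \<Phi> i w"
  by (rule linear_on_add[OF \<Phi>_linear])

lemma \<Phi>_scale: "u \<in> cell (Suc i) j \<Longrightarrow> \<Phi> i (fun_scale scale a u) = fun_scale scale a (\<Phi> i u)"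
  by (rule linear_on_scale[OF \<Phi>_linear])

lemma \<Phi>_0 [simp]: "\<Phi> i 0 = 0"
proof -
  have "0 \<in> cell (Suc i) j" for j by (rule fn.subspace_0[OF subspace_cell])
  from \<Phi>_scale[OF this, of 0] show ?thesis by simp
qed

lemma \<Phi>_neg: "u \<in> cell (Suc i) j \<Longrightarrow> \<Phi> i (- u) = - \<Phi> i u"
  using \<Phi>_add[of u i j "- u"] fn.subspace_neg[OF subspace_cell]
  by (simp add: eq_neg_iff_add_eq_0 add.commute)

lemma \<delta>_cell:
  assumes "u \<in> cell i j" shows "\<delta> j \<circ> u \<in> cell i (Suc j)"
  unfolding cell_def
proof (rule boxI)
  fix e assume "e \<in> B i"
  then show "(\<delta> j \<circ> u) e \<in> E (Suc j) (- dg i e)"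
    using boxD(1)[OF assms[unfolded cell_def]] by (simp add: \<delta>_in)
next
  fix e assume "e \<notin> B i"
  then show "(\<delta> j \<circ> u) e = 0"
    using boxD(2)[OF assms[unfolded cell_def]] by simp
qed

lemma cell_coordinate: "u \<in> cell i j \<Longrightarrow> u e \<in> E j (- dg i e)"
  using zero_E by (cases "e \<in> B i") (auto simp: cell_def box_def)

lemma \<delta>_cell_add: "u \<in> cell i j \<Longrightarrow> w \<in> cell i j \<Longrightarrow> \<delta> j \<circ> (u + w) = (\<delta> j \<circ> u) + (\<delta> j \<circ> w)"
  using \<delta>_add[OF cell_coordinate cell_coordinate] by (auto simp: fun_eq_iff)

lemma \<delta>_cell_neg: "u \<in> cell i j \<Longrightarrow> \<delta> j \<circ> (- u) = - (\<delta> j \<circ> u)"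
  using \<delta>_neg[OF cell_coordinate] by (auto simp: fun_eq_iff)

lemma \<delta>_cell_scale:
  "u \<in> cell i j \<Longrightarrow> \<delta> j \<circ> fun_scale scale a u = fun_scale scale a (\<delta> j \<circ> u)"
  using \<delta>_scale[OF cell_coordinate] by (auto simp: fun_eq_iff fun_scale_apply)

lemma \<delta>_\<delta>_cell: "u \<in> cell i j \<Longrightarrow> \<delta> (Suc j) \<circ> (\<delta> j \<circ> u) = 0"
  using \<delta>_\<delta>[OF cell_coordinate] by (auto simp: fun_eq_iff)

lemma cell_beyond: "n < j \<Longrightarrow> u \<in> cell i j \<Longrightarrow> u = 0"
  using cell_coordinate[of u i j] E_beyond[of j] by (auto simp: fun_eq_iff)

text \<open>The summand with index \<open>j\<close> of an element of \<open>Tot p\<close> lies in \<open>(F\<^sub>j\<^sub>+\<^sub>p \<otimes> E\<^sup>j)\<^sub>0\<close>.\<close>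

definition Tot :: "nat \<Rightarrow> (nat \<Rightarrow> 'i \<Rightarrow> 'e) set"
  where "Tot p = box {..n} (\<lambda>j. cell (j + p) j)"

lemma Tot_iff: "x \<in> Tot p \<longleftrightarrow> (\<forall>j. x j \<in> cell (j + p) j)"
proof
  assume x: "x \<in> Tot p"
  show "\<forall>j. x j \<in> cell (j + p) j"
  proof
    fix j show "x j \<in> cell (j + p) j"
      using boxD(1)[OF x[unfolded Tot_def], of j] boxD(2)[OF x[unfolded Tot_def], of j]
        fn.subspace_0[OF subspace_cell, of "j + p" j]
      by (cases "j \<le> n") auto
  qed
next
  assume x: "\<forall>j. x j \<in> cell (j + p) j"
  show "x \<in> Tot p" unfolding Tot_def
  proof (rule boxI)
    show "x j \<in> cell (j + p) j" for j using x by blast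
    show "x j = 0" if "j \<notin> {..n}" for j
      using that cell_beyond[of j "x j" "j + p"] x by simp
  qed
qed

lemma Tot_column: "x \<in> Tot p \<Longrightarrow> x j \<in> cell (j + p) j"
  by (simp add: Tot_iff)

lemma subspace_Tot: "fn2.subspace (Tot p)"
  unfolding Tot_def by (rule fn.box_subspace) (rule subspace_cell)

lemma fin_dim_Tot: "fn2.fin_dim (Tot p)"
  unfolding Tot_def by (rule fn.box_fin_dim) (simp_all add: fin_dim_cell)

text \<open>Multiplication by \<open>(-1)\<^sup>p\<close>. A sign that depends on the homological degree only is enough to make the
  commuting differentials \<open>\<Phi>\<close> and \<open>\<delta>\<close> anticommute.\<close>

definition sign_twist :: "nat \<Rightarrow> ('i \<Rightarrow> 'e) \<Rightarrow> 'i \<Rightarrow> 'e"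
  where "sign_twist p u = (if even p then u else - u)"

text \<open>The differential \<open>\<delta>\<close> moves the summand \<open>j\<close> to \<open>j + 1\<close>, so its value at \<open>0\<close> is zero.\<close>

fun delta_shift :: "(nat \<Rightarrow> 'i \<Rightarrow> 'e) \<Rightarrow> nat \<Rightarrow> 'i \<Rightarrow> 'e" where
  "delta_shift x 0 = 0"
| "delta_shift x (Suc j) = \<delta> j \<circ> x j"

definition dTot :: "nat \<Rightarrow> (nat \<Rightarrow> 'i \<Rightarrow> 'e) \<Rightarrow> nat \<Rightarrow> 'i \<Rightarrow> 'e"
  where "dTot p x j = \<Phi> (j + p) (x j) + sign_twist p (delta_shift x j)"

lemma sign_twist_0 [simp]: "sign_twist p 0 = 0"
  by (simp add: sign_twist_def fun_eq_iff)

lemma sign_twist_cell: "u \<in> cell i j \<Longrightarrow> sign_twist p u \<in> cell i j"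
  unfolding sign_twist_def using fn.subspace_neg[OF subspace_cell] by simp

lemma delta_shift_cell: "x \<in> Tot (Suc p) \<Longrightarrow> delta_shift x j \<in> cell (j + p) j"
proof (cases j)
  case 0
  then show ?thesis using fn.subspace_0[OF subspace_cell, of "j + p" j] by simp
next
  case (Suc k)
  assume "x \<in> Tot (Suc p)"
  from \<delta>_cell[OF Tot_column[OF this, of k]] Suc show ?thesis by simp
qed

lemma Tot_column_Suc: "x \<in> Tot (Suc p) \<Longrightarrow> x j \<in> cell (Suc (j + p)) j"
  using Tot_column[of x "Suc p" j] by simp

lemma dTot_in: assumes "x \<in> Tot (Suc p)" shows "dTot p x \<in> Tot p"
  unfolding Tot_iff
proof
  fix j
  show "dTot p x j \<in> cell (j + p) j"
    unfolding dTot_def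
    by (intro fn.subspace_add[OF subspace_cell] \<Phi>_in Tot_column_Suc sign_twist_cell delta_shift_cell assms)
qed

lemma dTot_linear:
  "linear_on (fun_scale (fun_scale scale)) (fun_scale (fun_scale scale)) (Tot (Suc p)) (dTot p)"
proof (rule linear_onI)
  fix x y assume x: "x \<in> Tot (Suc p)" and y: "y \<in> Tot (Suc p)"
  have "delta_shift (x + y) j = delta_shift x j + delta_shift y j" for j
    using \<delta>_cell_add[OF Tot_column[OF x] Tot_column[OF y]] by (cases j) simp_all
  then show "dTot p (x + y) = dTot p x + dTot p y"
    using \<Phi>_add[OF Tot_column_Suc[OF x] Tot_column_Suc[OF y]]
    by (simp add: fun_eq_iff[where 'a=nat] dTot_def sign_twist_def)
next
  fix a x assume x: "x \<in> Tot (Suc p)"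
  have "delta_shift (fun_scale (fun_scale scale) a x) j = fun_scale scale a (delta_shift x j)" for j
    using \<delta>_cell_scale[OF Tot_column[OF x]] by (cases j) (simp_all add: fun_scale_apply[of "fun_scale scale"])
  then show "dTot p (fun_scale (fun_scale scale) a x) = fun_scale (fun_scale scale) a (dTot p x)"
    using \<Phi>_scale[OF Tot_column_Suc[OF x]]
    by (simp add: fun_eq_iff[where 'a=nat] dTot_def sign_twist_def fun_scale_apply[of "fun_scale scale"]
        fn.scale_right_distrib fn.scale_minus_right)
qed

lemma \<Phi>_delta_shift:
  assumes x: "x \<in> Tot (Suc (Suc p))"
  shows "\<Phi> (j + p) (delta_shift x j) = delta_shift (\<lambda>k. \<Phi> (k + Suc p) (x k)) j"
proof (cases j)
  case (Suc k)
  have "x k \<in> cell (Suc (k + Suc p)) k" using Tot_column_Suc[OF x] .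
  from \<Phi>_\<delta>[OF this] Suc show ?thesis by simp
qed simp

lemma dTot_dTot:
  assumes x: "x \<in> Tot (Suc (Suc p))" shows "dTot p (dTot (Suc p) x) = 0"
proof
  fix j
  have c: "x j \<in> cell (Suc (Suc (j + p))) j" for j using Tot_column_Suc[OF x, of j] by simp
  have c1: "\<Phi> (j + Suc p) (x j) \<in> cell (Suc (j + p)) j" for j using \<Phi>_in[OF c[of j]] by simp
  have c2: "delta_shift x j \<in> cell (Suc (j + p)) j" for j using delta_shift_cell[OF x, of j] by simp
  have "\<Phi> (j + p) (dTot (Suc p) x j) = \<Phi> (j + p) (\<Phi> (j + Suc p) (x j)) + \<Phi> (j + p) (sign_twist (Suc p) (delta_shift x j))"
    unfolding dTot_def by (rule \<Phi>_add[OF c1 sign_twist_cell[OF c2]])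
  also have "\<dots> = sign_twist (Suc p) (\<Phi> (j + p) (delta_shift x j))"
    using \<Phi>_\<Phi>[OF c[of j]] \<Phi>_neg[OF c2[of j]] by (simp add: sign_twist_def)
  finally have 1: "\<Phi> (j + p) (dTot (Suc p) x j) = sign_twist (Suc p) (\<Phi> (j + p) (delta_shift x j))" .
  have 2: "delta_shift (dTot (Suc p) x) j = delta_shift (\<lambda>k. \<Phi> (k + Suc p) (x k)) j"
  proof (cases j)
    case (Suc k)
    have "\<delta> k \<circ> sign_twist (Suc p) (delta_shift x k) = 0"
    proof (cases k)
      case (Suc l)
      have "\<delta> (Suc l) \<circ> (\<delta> l \<circ> x l) = 0" by (rule \<delta>_\<delta>_cell[OF c])
      moreover have "\<delta> (Suc l) \<circ> (- (\<delta> l \<circ> x l)) = - (\<delta> (Suc l) \<circ> (\<delta> l \<circ> x l))"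
        by (rule \<delta>_cell_neg[OF \<delta>_cell[OF c]])
      ultimately show ?thesis using Suc by (simp add: sign_twist_def)
    qed (simp add: sign_twist_def fun_eq_iff)
    then have "\<delta> k \<circ> dTot (Suc p) x k = \<delta> k \<circ> \<Phi> (k + Suc p) (x k)"
      unfolding dTot_def using \<delta>_cell_add[OF c1[of k] sign_twist_cell[OF c2[of k], of "Suc p"]] by simp
    then show ?thesis using Suc by simp
  qed simp
  show "dTot p (dTot (Suc p) x) j = 0 j"
    unfolding dTot_def[of p] 1 2 \<Phi>_delta_shift[OF x] by (simp add: sign_twist_def)
qed

text \<open>The usual argument for a double complex with exact rows. A preimage \<open>y\<close> of \<open>x\<close> is constructed for
  increasing \<open>j\<close>: at \<open>j\<close> one has to solve \<open>\<Phi> (y j) = x j \<plusminus> \<delta> (y (j - 1))\<close>. The right-hand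
  side is a \<open>\<Phi>\<close>-cycle because \<open>dTot p x = 0\<close>, and the rows are exact at \<open>F\<^sub>j\<^sub>+\<^sub>p\<^sub>+\<^sub>1\<close>. The choice at \<open>j\<close>
  influences the next one only through \<open>\<delta> \<circ> \<Phi> (y j) = \<delta> \<circ> x j\<close>, which is the invariant.\<close>

lemma dTot_exact:
  assumes x: "x \<in> Tot (Suc p)" and Dx: "dTot p x = 0"
  shows "\<exists>y\<in>Tot (Suc (Suc p)). dTot (Suc p) y = x"
proof -
  have cx: "x j \<in> cell (Suc (j + p)) j" for j using Tot_column_Suc[OF x] .
  let ?good = "\<lambda>j u. u \<in> cell (j + Suc (Suc p)) j \<and> (j = 0 \<longrightarrow> \<Phi> (Suc p) u = x 0)"
  let ?step = "\<lambda>j u w. \<Phi> (Suc j + Suc p) w + sign_twist (Suc p) (\<delta> j \<circ> u) = x (Suc j)"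
  let ?inv = "\<lambda>j u. \<delta> j \<circ> \<Phi> (j + Suc p) u = \<delta> j \<circ> x j"
  have "\<exists>f. \<forall>j. (?good j (f j) \<and> ?inv j (f j)) \<and> ?step j (f j) (f (Suc j))"
  proof (rule dependent_nat_choice)
    have "\<Phi> p (x 0) = 0" using fun_cong[OF Dx, of 0] by (simp add: dTot_def)
    from \<Phi>_exact[of "x 0" p 0, OF _ this] cx[of 0]
    obtain w where "w \<in> cell (Suc (Suc p)) 0" "\<Phi> (Suc p) w = x 0" by auto
    then show "\<exists>u. ?good 0 u \<and> ?inv 0 u" by (intro exI[of _ w]) simp
  next
    fix u j assume u: "?good j u \<and> ?inv j u"
    then have cu: "u \<in> cell (Suc (Suc (j + p))) j" by simp
    let ?z = "x (Suc j) + sign_twist p (\<delta> j \<circ> u)"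
    have cz: "sign_twist p (\<delta> j \<circ> u) \<in> cell (Suc (Suc j + p)) (Suc j)"
      using sign_twist_cell[OF \<delta>_cell[OF cu]] by simp
    have "\<Phi> (Suc j + p) ?z = \<Phi> (Suc j + p) (x (Suc j)) + \<Phi> (Suc j + p) (sign_twist p (\<delta> j \<circ> u))"
      by (rule \<Phi>_add[OF cx cz])
    also have "\<Phi> (Suc j + p) (sign_twist p (\<delta> j \<circ> u)) = sign_twist p (\<delta> j \<circ> x j)"
    proof -
      have "\<Phi> (Suc j + p) (\<delta> j \<circ> u) = \<delta> j \<circ> x j"
        using \<Phi>_\<delta>[OF cu] u by simp
      moreover have "\<delta> j \<circ> u \<in> cell (Suc (Suc j + p)) (Suc j)" using \<delta>_cell[OF cu] by simp
      ultimately show ?thesis using \<Phi>_neg[of "\<delta> j \<circ> u" "Suc j + p" "Suc j"] by (simp add: sign_twist_def)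
    qed
    also have "\<Phi> (Suc j + p) (x (Suc j)) + sign_twist p (\<delta> j \<circ> x j) = 0"
      using fun_cong[OF Dx, of "Suc j"] by (simp add: dTot_def)
    finally have "\<Phi> (Suc j + p) ?z = 0" .
    from \<Phi>_exact[OF fn.subspace_add[OF subspace_cell cx cz] this]
    obtain w where w: "w \<in> cell (Suc (Suc (Suc j + p))) (Suc j)" "\<Phi> (Suc (Suc j + p)) w = ?z"
      by blast
    have "?step j u w" using w(2) by (simp add: sign_twist_def)
    moreover have "?inv (Suc j) w"
    proof -
      have 0: "\<delta> (Suc j) \<circ> sign_twist p (\<delta> j \<circ> u) = 0"
        using \<delta>_\<delta>_cell[OF cu] \<delta>_cell_neg[OF \<delta>_cell[OF cu]] by (simp add: sign_twist_def)
      then have "\<delta> (Suc j) \<circ> ?z = \<delta> (Suc j) \<circ> x (Suc j)"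
        using \<delta>_cell_add[OF cx cz] by simp
      then show ?thesis using w(2) by simp
    qed
    ultimately show "\<exists>w. (?good (Suc j) w \<and> ?inv (Suc j) w) \<and> ?step j u w"
      using w(1) by (intro exI[of _ w]) simp
  qed
  then obtain f where f: "\<And>j. ?good j (f j)" "\<And>j. ?step j (f j) (f (Suc j))" by blast
  have "f \<in> Tot (Suc (Suc p))" unfolding Tot_iff using f(1) by blast
  moreover have "dTot (Suc p) f = x"
  proof
    fix j show "dTot (Suc p) f j = x j"
    proof (cases j)
      case 0
      then show ?thesis using f(1)[of 0] by (simp add: dTot_def sign_twist_def)
    next
      case (Suc k)
      then show ?thesis using f(2)[of k] by (simp add: dTot_def)
    qed
  qed
  ultimately show ?thesis by blast
qed

abbreviation cocyc :: "nat \<Rightarrow> int \<Rightarrow> 'e set"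
  where "cocyc \<equiv> cocycles E \<delta>"

abbreviation cobd :: "nat \<Rightarrow> int \<Rightarrow> 'e set"
  where "cobd \<equiv> coboundaries E \<delta>"

text \<open>The first identity gives \<open>\<delta>\<close> its rank: \<open>dim (E j d) - dim (cocyc j d)\<close> is the dimension of the
  coboundaries one position further.\<close>

lemma rank_nullity_\<delta>:
  shows "dim (E j d) = dim (cocyc j d) + dim (cobd (Suc j) d)"
    and "subspace (cocyc j d)" and "subspace (cobd j d)" and "fin_dim (cobd j d)"
proof -
  interpret p: vector_space_pair scale scale by unfold_locales
  note rn = p.rank_nullity[OF subspace_E fin_dim_E \<delta>_linear]
  show "dim (E j d) = dim (cocyc j d) + dim (cobd (Suc j) d)" and "subspace (cocyc j d)"
    using rn(1,2)[of j d] by (simp_all add: cocycles_def coboundaries_def)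
  show "subspace (cobd j d)" using rn(3) by (cases j) (simp_all add: coboundaries_def)
  show "fin_dim (cobd j d)" using rn(4) by (cases j) (simp_all add: coboundaries_def fin_dim_singleton)
qed

lemma cobd_subset_cocyc: "cobd j d \<subseteq> cocyc j d"
  using \<delta>_in \<delta>_\<delta> zero_E by (cases j) (auto simp: coboundaries_def cocycles_def)

lemma cocyc_subset_E: "cocyc j d \<subseteq> E j d"
  by (auto simp: cocycles_def)

text \<open>The splitting \<open>E j d = H \<oplus> B \<oplus> C\<close>: \<open>H j d\<close> is a complement of the coboundaries in the
  cocycles, hence a copy of the cohomology, and \<open>C j d\<close> is a complement of the cocycles. In the
  comments on dimensions below, \<open>B\<close> stands for the coboundaries \<open>cobd j d\<close> as in the introduction, and not
  for the bases of the \<open>F\<^sub>i\<close>.\<close>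

definition H :: "nat \<Rightarrow> int \<Rightarrow> 'e set"
  where "H j d = (SOME W. is_complement (cobd j d) (cocyc j d) W)"

definition C :: "nat \<Rightarrow> int \<Rightarrow> 'e set"
  where "C j d = (SOME W. is_complement (cocyc j d) (E j d) W)"

lemma H_complement: "is_complement (cobd j d) (cocyc j d) (H j d)"
  unfolding H_def
  by (rule someI_ex, rule is_complement_exists)
    (rule rank_nullity_\<delta> cobd_subset_cocyc)+

lemma C_complement: "is_complement (cocyc j d) (E j d) (C j d)"
  unfolding C_def
  by (rule someI_ex, rule is_complement_exists)
    (rule rank_nullity_\<delta> subspace_E cocyc_subset_E)+

lemma H_subset_cocyc: "H j d \<subseteq> cocyc j d" and subspace_H: "subspace (H j d)"
  and cobd_Int_H: "cobd j d \<inter> H j d = {0}"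
  using H_complement[of j d] by (simp_all add: is_complement_def)

lemma C_subset_E: "C j d \<subseteq> E j d" and subspace_C: "subspace (C j d)"
  and cocyc_Int_C: "cocyc j d \<inter> C j d = {0}"
  using C_complement[of j d] by (simp_all add: is_complement_def)

lemma H_subset_E: "H j d \<subseteq> E j d" and cobd_subset_E: "cobd j d \<subseteq> E j d"
  using H_subset_cocyc cobd_subset_cocyc cocyc_subset_E by blast+

lemma fin_dim_H: "fin_dim (H j d)" and fin_dim_C: "fin_dim (C j d)" and fin_dim_cocyc: "fin_dim (cocyc j d)"
  by (rule fin_dim_subset[OF fin_dim_E H_subset_E] fin_dim_subset[OF fin_dim_E C_subset_E]
      fin_dim_subset[OF fin_dim_E cocyc_subset_E])+

definition h :: "nat \<Rightarrow> int \<Rightarrow> nat" where "h j d = dim (H j d)"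
definition b :: "nat \<Rightarrow> int \<Rightarrow> nat" where "b j d = dim (cobd j d)"

lemma dim_cocyc: "dim (cocyc j d) = b j d + h j d"
  unfolding b_def h_def
  by (rule dim_is_complement[OF H_complement])
    (rule rank_nullity_\<delta> fin_dim_cocyc cobd_subset_cocyc)+

lemma dim_C: "dim (C j d) = b (Suc j) d"
  using dim_is_complement[OF C_complement _ subspace_E fin_dim_E cocyc_subset_E, of j d]
    rank_nullity_\<delta>[of j d] unfolding b_def by simp

lemma dim_E: "dim (E j d) = h j d + b j d + b (Suc j) d"
  using rank_nullity_\<delta>(1)[of j d] dim_cocyc[of j d] unfolding b_def by simp

lemma b_0: "b 0 d = 0" by (simp add: b_def coboundaries_def)

lemma dim_H_plus_C: "dim (sum_space (H j d) (C j d)) = h j d + b (Suc j) d"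
    "subspace (sum_space (H j d) (C j d))" "fin_dim (sum_space (H j d) (C j d))"
proof -
  have "H j d \<inter> C j d \<subseteq> {0}" using H_subset_cocyc[of j d] cocyc_Int_C[of j d] by blast
  note * = dim_sum_space[OF subspace_H fin_dim_H subspace_C fin_dim_C this]
  show "dim (sum_space (H j d) (C j d)) = h j d + b (Suc j) d" "fin_dim (sum_space (H j d) (C j d))"
    using * by (simp_all add: h_def dim_C)
  show "subspace (sum_space (H j d) (C j d))" by (rule subspace_sums[OF subspace_H subspace_C])
qed

lemma dim_cobd_plus_C: "dim (sum_space (cobd j d) (C j d)) = b j d + b (Suc j) d"
    "subspace (sum_space (cobd j d) (C j d))" "fin_dim (sum_space (cobd j d) (C j d))"
proof -
  have "cobd j d \<inter> C j d \<subseteq> {0}" using cobd_subset_cocyc[of j d] cocyc_Int_C[of j d] by blast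
  note * = dim_sum_space[OF rank_nullity_\<delta>(3,4) subspace_C fin_dim_C this]
  show "dim (sum_space (cobd j d) (C j d)) = b j d + b (Suc j) d" "fin_dim (sum_space (cobd j d) (C j d))"
    using * by (simp_all add: b_def dim_C)
  show "subspace (sum_space (cobd j d) (C j d))" by (rule subspace_sums[OF rank_nullity_\<delta>(3) subspace_C])
qed

text \<open>The subspaces of \<open>Tot p\<close> in the proof are all given by conditions on single coordinates, that is, by
  a subspace \<open>Y j e\<close> of \<open>E j (- dg (j + p) e)\<close> for each summand \<open>j\<close> and each basis element \<open>e\<close> of
  \<open>F\<^sub>j\<^sub>+\<^sub>p\<close>. Their dimensions are sums over coordinates.\<close>

definition coord_box :: "nat \<Rightarrow> (nat \<Rightarrow> 'i \<Rightarrow> 'e set) \<Rightarrow> (nat \<Rightarrow> 'i \<Rightarrow> 'e) set"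
  where "coord_box p Y = box {..n} (\<lambda>j. box (B (j + p)) (Y j))"

lemma coord_box_mono: "(\<And>j e. Y j e \<subseteq> Y' j e) \<Longrightarrow> coord_box p Y \<subseteq> coord_box p Y'"
  unfolding coord_box_def by (intro box_mono) blast

lemma Tot_eq_coord_box: "Tot p = coord_box p (\<lambda>j e. E j (- dg (j + p) e))"
  unfolding Tot_def coord_box_def cell_def ..

lemma coord_box_coordinate:
  assumes "x \<in> coord_box p Y" "j \<le> n" "e \<in> B (j + p)" shows "x j e \<in> Y j e"
proof -
  have "x j \<in> box (B (j + p)) (Y j)" using boxD(1)[OF assms(1)[unfolded coord_box_def], of j] assms(2) by simp
  from boxD(1)[OF this assms(3)] show ?thesis .
qed

lemma coord_boxI:
  assumes x: "x \<in> Tot p" and Y: "\<And>j e. j \<le> n \<Longrightarrow> e \<in> B (j + p) \<Longrightarrow> x j e \<in> Y j e"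
  shows "x \<in> coord_box p Y"
  unfolding coord_box_def
proof (rule boxI)
  fix j assume j: "j \<in> {..n}"
  show "x j \<in> box (B (j + p)) (Y j)"
  proof (rule boxI)
    show "x j e \<in> Y j e" if "e \<in> B (j + p)" for e using Y j that by simp
    show "x j e = 0" if "e \<notin> B (j + p)" for e
      using boxD(2)[OF Tot_column[OF x, unfolded cell_def] that] .
  qed
next
  show "x j = 0" if "j \<notin> {..n}" for j
    using boxD(2)[OF x[unfolded Tot_def] that] .
qed

lemma subspace_coord_box: "(\<And>j e. subspace (Y j e)) \<Longrightarrow> fn2.subspace (coord_box p Y)"
  unfolding coord_box_def by (intro fn.box_subspace box_subspace)

lemma fin_dim_coord_box: "(\<And>j e. fin_dim (Y j e)) \<Longrightarrow> fn2.fin_dim (coord_box p Y)"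
  unfolding coord_box_def by (intro fn.box_fin_dim box_fin_dim finite_B) simp_all

lemma dim_coord_box:
  assumes "\<And>j e. subspace (Y j e)" "\<And>j e. fin_dim (Y j e)"
  shows "fn2.dim (coord_box p Y) = (\<Sum>j\<le>n. \<Sum>e\<in>B (j + p). dim (Y j e))"
proof -
  have "fn2.dim (coord_box p Y) = (\<Sum>j\<le>n. fn.dim (box (B (j + p)) (Y j)))"
    unfolding coord_box_def
    by (rule fn.dim_box) (simp_all add: box_subspace box_fin_dim finite_B assms)
  also have "\<dots> = (\<Sum>j\<le>n. \<Sum>e\<in>B (j + p). dim (Y j e))"
    by (intro sum.cong refl dim_box finite_B assms)
  finally show ?thesis .
qed

text \<open>Induction from large \<open>j\<close> downwards. It is the right order for \<open>\<delta>\<close>: the summand \<open>j\<close> of an element is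
  seen by \<open>\<delta>\<close> at \<open>j + 1\<close>.\<close>

lemma descending:
  assumes "\<And>j. n < j \<Longrightarrow> P j" "\<And>j. P (Suc j) \<Longrightarrow> P j" shows "P j"
  by (rule inc_induct[of j "Suc (max j n)"]) (auto intro: assms)

text \<open>If the summand \<open>j + 1\<close> of the boundary \<open>y\<close> vanishes, then \<open>\<delta> (y j) = 0\<close>, since \<open>y\<close> is annihilated
  by the differential of the total complex in degree \<open>0\<close> as well; but \<open>C\<close> contains no nonzero
  cocycles. That differential would leave the range \<open>p \<ge> 0\<close>, so the computation is done directly.\<close>

lemma boundary_in_C_eq_0:
  assumes x: "x \<in> Tot (Suc 0)" and dTot: "dTot 0 x \<in> coord_box 0 (\<lambda>j e. C j (- dg j e))"
  shows "dTot 0 x = 0"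
proof
  fix j
  have Tot: "dTot 0 x \<in> Tot 0" using dTot_in[OF x] .
  have cx: "x j \<in> cell (Suc j) j" for j using Tot_column[OF x, of j] by simp
  have cD: "dTot 0 x j \<in> cell j j" for j using Tot_column[OF Tot, of j] by simp
  show "dTot 0 x j = 0 j"
  proof (induction j rule: descending)
    fix j assume "n < j"
    then show "dTot 0 x j = 0 j" using cell_beyond[OF _ cD[of j]] by simp
  next
    fix j assume IH: "dTot 0 x (Suc j) = 0 (Suc j)"
    have "\<delta> j \<circ> dTot 0 x j = \<delta> j \<circ> \<Phi> j (x j)"
    proof -
      have "\<delta> j \<circ> delta_shift x j = 0" 
      proof (cases j)
        case (Suc k) then show ?thesis using \<delta>_\<delta>_cell[OF cx[of k]] by simp
      qed (simp add: fun_eq_iff)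
      moreover have "dTot 0 x j = \<Phi> j (x j) + delta_shift x j" by (simp add: dTot_def sign_twist_def)
      ultimately show ?thesis
        using \<delta>_cell_add[OF \<Phi>_in[OF cx[of j]], of "delta_shift x j"] delta_shift_cell[OF x, of j] by simp
    qed
    also have "\<dots> = \<Phi> j (\<delta> j \<circ> x j)" using \<Phi>_\<delta>[OF cx[of j]] by simp
    also have "\<delta> j \<circ> x j = - \<Phi> (Suc j) (x (Suc j))"
      using IH by (simp add: dTot_def sign_twist_def eq_neg_iff_add_eq_0 add.commute)
    also have "\<Phi> j (- \<Phi> (Suc j) (x (Suc j))) = 0"
      using \<Phi>_neg[OF \<Phi>_in[OF cx]] \<Phi>_\<Phi>[OF cx] by simp
    finally have \<delta>dTot: "\<delta> j \<circ> dTot 0 x j = 0" .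
    have "dTot 0 x j e = 0" for e
    proof (cases "j \<le> n \<and> e \<in> B j")
      case True
      then have "dTot 0 x j e \<in> C j (- dg j e)" using coord_box_coordinate[OF dTot, of j e] by simp
      moreover from this have "dTot 0 x j e \<in> cocyc j (- dg j e)"
        using subsetD[OF C_subset_E] fun_cong[OF \<delta>dTot, of e] by (simp add: cocycles_def)
      ultimately show ?thesis using cocyc_Int_C[of j "- dg j e"] by blast
    next
      case False
      then show ?thesis using cell_beyond[OF _ cD[of j]] cD[of j]
        by (cases "j \<le> n") (auto simp: cell_def box_def)
    qed
    then show "dTot 0 x j = 0 j" by (simp add: fun_eq_iff)
  qed
qed

text \<open>If the summand \<open>j + 1\<close> of \<open>x\<close> vanishes, the summand \<open>j + 1\<close> of its boundary is \<open>- \<delta> (x j)\<close>, a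
  coboundary in \<open>H \<oplus> C\<close>, hence zero. In particular the differential is injective on \<open>C\<^sub>2\<close>.\<close>

lemma C_eq_0_if_boundary_in_H_plus_C:
  assumes x: "x \<in> coord_box (Suc (Suc 0)) (\<lambda>j e. C j (- dg (j + Suc (Suc 0)) e))"
    and dTot: "dTot (Suc 0) x \<in> coord_box (Suc 0) (\<lambda>j e. sum_space (H j (- dg (j + Suc 0) e)) (C j (- dg (j + Suc 0) e)))"
  shows "x = 0"
proof
  fix j
  have Tot: "x \<in> Tot (Suc (Suc 0))"
    using x coord_box_mono[of "\<lambda>j e. C j (- dg (j + Suc (Suc 0)) e)"
        "\<lambda>j e. E j (- dg (j + Suc (Suc 0)) e)"] C_subset_E unfolding Tot_eq_coord_box by auto
  have cx: "x j \<in> cell (Suc (Suc j)) j" for j using Tot_column[OF Tot, of j] by simp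
  show "x j = 0 j"
  proof (induction j rule: descending)
    fix j assume "n < j"
    then show "x j = 0 j" using cell_beyond[OF _ cx[of j]] by simp
  next
    fix j assume IH: "x (Suc j) = 0 (Suc j)"
    have Dj: "dTot (Suc 0) x (Suc j) = - (\<delta> j \<circ> x j)" using IH by (simp add: dTot_def sign_twist_def)
    have "x j e = 0" for e
    proof (cases "j \<le> n \<and> e \<in> B (Suc (Suc j))")
      case True
      let ?d = "- dg (Suc (Suc j)) e"
      have xC: "x j e \<in> C j ?d" using coord_box_coordinate[OF x, of j e] True by simp
      then have xE: "x j e \<in> E j ?d" by (rule subsetD[OF C_subset_E])
      have "\<delta> j (x j e) = 0"
      proof (cases "Suc j \<le> n")
        case False
        then show ?thesis using \<delta>_in[OF xE] E_beyond[of "Suc j" ?d] by simp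
      next
        case j: True
        let ?y = "- \<delta> j (x j e)"
        have "dTot (Suc 0) x (Suc j) e \<in> sum_space (H (Suc j) ?d) (C (Suc j) ?d)"
          using coord_box_coordinate[OF dTot j, of e] True by simp
        then obtain u w where uw: "?y = u + w" "u \<in> H (Suc j) ?d" "w \<in> C (Suc j) ?d"
          unfolding Dj by auto
        have y: "?y \<in> cobd (Suc j) ?d"
          using xE subspace_neg[OF rank_nullity_\<delta>(3)[of "Suc j" ?d]] by (simp add: coboundaries_def)
        then have "?y \<in> cocyc (Suc j) ?d" by (rule subsetD[OF cobd_subset_cocyc])
        moreover have "u \<in> cocyc (Suc j) ?d" using uw(2) by (rule subsetD[OF H_subset_cocyc])
        ultimately have "?y - u \<in> cocyc (Suc j) ?d" by (rule subspace_diff[OF rank_nullity_\<delta>(2)])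
        then have "w \<in> cocyc (Suc j) ?d" using uw(1) by (simp add: diff_eq_eq)
        then have "w = 0" using uw(3) cocyc_Int_C[of "Suc j" ?d] by blast
        then have "?y \<in> H (Suc j) ?d" using uw by simp
        then have "?y = 0" using y cobd_Int_H[of "Suc j" ?d] by blast
        then show ?thesis by simp
      qed
      then have "x j e \<in> cocyc j ?d" using xE by (simp add: cocycles_def)
      then show ?thesis using xC cocyc_Int_C[of j ?d] by blast
    next
      case False
      then show ?thesis using cell_beyond[OF _ cx[of j]] cx[of j]
        by (cases "j \<le> n") (auto simp: cell_def box_def)
    qed
    then show "x j = 0 j" by (simp add: fun_eq_iff)
  qed
qed

text \<open>The cycles of \<open>Tot (p + 1)\<close>: like the differentials, they are indexed by the degree of the target.\<close>

definition Tot_cycles :: "nat \<Rightarrow> (nat \<Rightarrow> 'i \<Rightarrow> 'e) set"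
  where "Tot_cycles p = {x \<in> Tot (Suc p). dTot p x = 0}"

lemma rank_nullity_dTot:
  assumes W: "fn2.subspace W" "W \<subseteq> Tot (Suc p)"
  shows "fn2.dim W = fn2.dim {x \<in> W. dTot p x = 0} + fn2.dim (dTot p ` W)"
    and "fn2.subspace {x \<in> W. dTot p x = 0}" and "fn2.subspace (dTot p ` W)"
proof -
  interpret p: vector_space_pair
    "fun_scale (fun_scale scale) :: 'k \<Rightarrow> (nat \<Rightarrow> 'i \<Rightarrow> 'e) \<Rightarrow> nat \<Rightarrow> 'i \<Rightarrow> 'e"
    "fun_scale (fun_scale scale) :: 'k \<Rightarrow> (nat \<Rightarrow> 'i \<Rightarrow> 'e) \<Rightarrow> nat \<Rightarrow> 'i \<Rightarrow> 'e"
    by unfold_locales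
  note rn = p.rank_nullity[OF W(1) fn2.fin_dim_subset[OF fin_dim_Tot W(2)] linear_on_subset[OF dTot_linear W(2)]]
  show "fn2.dim W = fn2.dim {x \<in> W. dTot p x = 0} + fn2.dim (dTot p ` W)"
    "fn2.subspace {x \<in> W. dTot p x = 0}" "fn2.subspace (dTot p ` W)"
    by (rule rn(1) rn(2) rn(3))+
qed

lemma dTot_image_Tot: "dTot (Suc p) ` Tot (Suc (Suc p)) = Tot_cycles p"
proof
  show "dTot (Suc p) ` Tot (Suc (Suc p)) \<subseteq> Tot_cycles p"
    unfolding Tot_cycles_def using dTot_in dTot_dTot by (intro image_subsetI) simp
  show "Tot_cycles p \<subseteq> dTot (Suc p) ` Tot (Suc (Suc p))"
  proof
    fix x assume "x \<in> Tot_cycles p"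
    then have "x \<in> Tot (Suc p)" "dTot p x = 0" by (simp_all add: Tot_cycles_def)
    from dTot_exact[OF this] obtain y where y: "y \<in> Tot (Suc (Suc p))" "dTot (Suc p) y = x" ..
    from y(1) show "x \<in> dTot (Suc p) ` Tot (Suc (Suc p))" by (rule rev_image_eqI) (simp add: y(2))
  qed
qed

lemma dim_Tot_exact: "fn2.dim (Tot (Suc (Suc p))) = fn2.dim (Tot_cycles (Suc p)) + fn2.dim (Tot_cycles p)"
  using rank_nullity_dTot(1)[OF subspace_Tot order_refl, of "Suc p"] unfolding dTot_image_Tot Tot_cycles_def by simp

text \<open>The dimensions of \<open>(F\<^sub>j\<^sub>+\<^sub>p \<otimes> H)\<^sub>0\<close>, \<open>(F\<^sub>j\<^sub>+\<^sub>p \<otimes> B)\<^sub>0\<close> and \<open>(F\<^sub>j\<^sub>+\<^sub>p \<otimes> C)\<^sub>0\<close> in position \<open>j\<close>.\<close>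

definition hsum :: "nat \<Rightarrow> nat \<Rightarrow> nat" where "hsum p j = (\<Sum>e\<in>B (j + p). h j (- dg (j + p) e))"
definition bsum :: "nat \<Rightarrow> nat \<Rightarrow> nat" where "bsum p j = (\<Sum>e\<in>B (j + p). b j (- dg (j + p) e))"
definition csum :: "nat \<Rightarrow> nat \<Rightarrow> nat" where "csum p j = (\<Sum>e\<in>B (j + p). b (Suc j) (- dg (j + p) e))"

lemma dim_Tot: "fn2.dim (Tot p) = (\<Sum>j\<le>n. hsum p j) + (\<Sum>j\<le>n. bsum p j) + (\<Sum>j\<le>n. csum p j)"
  unfolding Tot_eq_coord_box
  by (subst dim_coord_box) (simp_all add: subspace_E fin_dim_E dim_E sum.distrib hsum_def bsum_def csum_def)

text \<open>Both sides belong to the basis of the same \<open>F\<^sub>i\<close>, \<open>i = j + p + 1\<close>, and \<open>\<delta>\<close> is an isomorphism from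
  \<open>C\<close> in position \<open>j\<close> to \<open>B\<close> in position \<open>j + 1\<close>.\<close>

lemma bsum_Suc: "bsum p (Suc j) = csum (Suc p) j"
  by (simp add: bsum_def csum_def)

lemma bsum_0: "bsum p 0 = 0"
  by (simp add: bsum_def b_0)

lemma sum_bsum: "(\<Sum>j\<le>k. bsum p j) = (\<Sum>j<k. csum (Suc p) j)"
proof -
  have "(\<Sum>j\<le>k. bsum p j) = bsum p 0 + (\<Sum>j<k. bsum p (Suc j))"
    by (simp add: lessThan_Suc_atMost[symmetric] sum.lessThan_Suc_shift del: sum.lessThan_Suc)
  then show ?thesis by (simp add: bsum_0 bsum_Suc)
qed

lemma csum_n: "csum p n = 0"
proof -
  have "cobd (Suc n) d = {0}" for d
    using cobd_subset_E[of "Suc n" d] E_beyond[of "Suc n" d] subspace_0[OF rank_nullity_\<delta>(3), of "Suc n" d]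
    by simp blast
  then show ?thesis by (simp add: csum_def b_def)
qed

lemma sum_bsum_eq_sum_csum: "(\<Sum>j\<le>n. bsum p j) = (\<Sum>j\<le>n. csum (Suc p) j)"
  unfolding sum_bsum by (simp add: lessThan_Suc_atMost[symmetric] csum_n)

lemma alternating_dim_Tot:
  "(\<Sum>q<Q. (-1) ^ q * int (fn2.dim (Tot (Suc (Suc q))))) = int (fn2.dim (Tot_cycles 0)) - (-1) ^ Q * int (fn2.dim (Tot_cycles Q))"
  by (induction Q) (simp_all add: dim_Tot_exact algebra_simps)

text \<open>By exactness \<open>dim Tot\<^sub>p = dim Z\<^sub>p + dim Z\<^sub>p\<^sub>-\<^sub>1\<close> for \<open>p \<ge> 2\<close>, so the alternating sum of these
  dimensions telescopes to \<open>dim Z\<^sub>1\<close>, which is called \<open>Tot_cycles 0\<close>. Expanding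
  \<open>dim Tot\<^sub>p = dim H\<^sub>p + dim C\<^sub>p\<^sub>+\<^sub>1 + dim C\<^sub>p\<close>, the terms with \<open>C\<close> telescope to \<open>dim C\<^sub>2\<close>.\<close>

lemma alternating_hsum:
  assumes vanish: "\<And>i e j. Q \<le> i \<Longrightarrow> e \<in> B i \<Longrightarrow> E j (- dg i e) = {0}"
  shows "int (fn2.dim (Tot_cycles 0)) = (\<Sum>q<Q. (-1) ^ q * int (\<Sum>j\<le>n. hsum (Suc (Suc q)) j)) + int (\<Sum>j\<le>n. csum (Suc (Suc 0)) j)"
proof -
  let ?h = "\<lambda>q. int (\<Sum>j\<le>n. hsum (Suc (Suc q)) j)" and ?c = "\<lambda>q. int (\<Sum>j\<le>n. csum (Suc (Suc q)) j)"
  have Tot: "int (fn2.dim (Tot (Suc (Suc q)))) = ?h q + ?c (Suc q) + ?c q" for q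
    by (simp add: dim_Tot sum_bsum_eq_sum_csum)
  have alt: "(\<Sum>q<R. (-1) ^ q * (?h q + ?c (Suc q) + ?c q)) = (\<Sum>q<R. (-1) ^ q * ?h q) + ?c 0 - (-1) ^ R * ?c R" for R
    by (induction R) (simp_all add: algebra_simps)
  have cell0: "cell i j = {0}" if "Q \<le> i" for i j
  proof -
    have "u = 0" if u: "u \<in> cell i j" for u
    proof
      fix e show "u e = 0 e"
        using boxD[OF u[unfolded cell_def], of e] vanish[OF \<open>Q \<le> i\<close>, of e j]
        by (cases "e \<in> B i") simp_all
    qed
    then show ?thesis using fn.subspace_0[OF subspace_cell, of i j] by blast
  qed
  have "x = 0" if "Q \<le> p" "x \<in> Tot p" for p x
  proof (rule ext)
    fix j show "x j = 0 j"
      using Tot_column[OF that(2), of j] that(1) cell0[of "j + p" j] by simp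
  qed
  then have "Tot p = {0}" if "Q \<le> p" for p
    using that fn2.subspace_0[OF subspace_Tot, of p] by blast
  then have V0: "fn2.dim (Tot p) = 0" if "Q \<le> p" for p using that by simp
  have "fn2.dim (Tot_cycles Q) \<le> fn2.dim (Tot (Suc Q))"
    unfolding Tot_cycles_def
    by (rule fn2.dim_mono_fin_dim[OF rank_nullity_dTot(2)[OF subspace_Tot order_refl] fin_dim_Tot]) simp
  then have Q: "fn2.dim (Tot_cycles Q) = 0" "fn2.dim (Tot (Suc (Suc Q))) = 0" using V0 by simp_all
  have "?c Q = 0" using Tot[of Q] Q(2) by linarith
  then show ?thesis using alternating_dim_Tot[of Q] alt[of Q] Q(1) unfolding Tot by simp
qed

text \<open>The space \<open>N = H'\<^sub>1 + C'\<^sub>1\<close> in \<open>Tot\<^sub>1\<close>: \<open>H\<close> and \<open>C\<close> for \<open>j < \<tau>\<close>, and in position \<open>\<tau>\<close> only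
  \<open>H\<close> on generators of degree at most \<open>c + 1\<close>.\<close>

definition Tot1_part :: "nat \<Rightarrow> int \<Rightarrow> (nat \<Rightarrow> 'i \<Rightarrow> 'e) set"
  where "Tot1_part \<tau> c = coord_box (Suc 0) (\<lambda>j e. let d = - dg (j + Suc 0) e in
    if j < \<tau> then sum_space (H j d) (C j d)
    else if j = \<tau> \<and> dg (j + Suc 0) e \<le> c + 1 then H j d else {0})"

text \<open>The space \<open>H'\<^sub>0 + B'\<^sub>0 + C\<^sub>0\<close> in \<open>Tot\<^sub>0\<close>: all of \<open>E\<close> where \<open>H\<close> is admitted, and \<open>B \<oplus> C\<close> or \<open>C\<close>
  elsewhere. The coboundaries in position \<open>\<tau>\<close> have to be included for every generator: they receive
  \<open>\<delta>\<close> from the \<open>C\<close>-part in position \<open>\<tau> - 1\<close>, which is not restricted by degree.\<close>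

definition Tot0_part :: "nat \<Rightarrow> int \<Rightarrow> (nat \<Rightarrow> 'i \<Rightarrow> 'e) set"
  where "Tot0_part \<tau> c = coord_box 0 (\<lambda>j e. let d = - dg (j + 0) e in
    if j < \<tau> \<or> j = \<tau> \<and> dg (j + 0) e \<le> c then E j d
    else if j = \<tau> then sum_space (cobd j d) (C j d) else C j d)"

lemma H_plus_C_subset_E: "sum_space (H j d) (C j d) \<subseteq> E j d"
  using subsetD[OF H_subset_E] subsetD[OF C_subset_E] add_E by auto

lemma Tot1_part_subset_Tot: "Tot1_part \<tau> c \<subseteq> Tot (Suc 0)"
  unfolding Tot1_part_def Tot_eq_coord_box
proof (rule coord_box_mono)
  fix j e
  show "(let d = - dg (j + Suc 0) e in
    if j < \<tau> then sum_space (H j d) (C j d)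
    else if j = \<tau> \<and> dg (j + Suc 0) e \<le> c + 1 then H j d else {0}) \<subseteq> E j (- dg (j + Suc 0) e)"
    using H_plus_C_subset_E[of j "- dg (j + Suc 0) e"] H_subset_E[of j "- dg (j + Suc 0) e"]
      zero_E[of j "- dg (j + Suc 0) e"]
    by (cases "j < \<tau>"; cases "j = \<tau>"; cases "dg (j + Suc 0) e \<le> c + 1") (simp_all add: Let_def)
qed

lemma Tot1_part_subset_H_plus_C:
  "Tot1_part \<tau> c \<subseteq> coord_box (Suc 0) (\<lambda>j e. sum_space (H j (- dg (j + Suc 0) e)) (C j (- dg (j + Suc 0) e)))"
  unfolding Tot1_part_def
proof (rule coord_box_mono)
  fix j e
  let ?d = "- dg (j + Suc 0) e"
  have 1: "H j ?d \<subseteq> sum_space (H j ?d) (C j ?d)"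
  proof
    fix x assume "x \<in> H j ?d"
    then have "x = x + 0 \<and> x \<in> H j ?d \<and> 0 \<in> C j ?d" using subspace_0[OF subspace_C] by simp
    then show "x \<in> sum_space (H j ?d) (C j ?d)" by blast
  qed
  have "0 \<in> sum_space (H j ?d) (C j ?d)" using subspace_0[OF dim_H_plus_C(2)] .
  with 1 show "(let d = ?d in if j < \<tau> then sum_space (H j d) (C j d)
    else if j = \<tau> \<and> dg (j + Suc 0) e \<le> c + 1 then H j d else {0}) \<subseteq> sum_space (H j ?d) (C j ?d)"
    unfolding Let_def by (split if_split)+ blast
qed

text \<open>Positions \<open>j < \<tau>\<close> of the target are unrestricted. In position \<open>\<tau>\<close>, a generator of degree larger
  than \<open>c\<close> receives nothing from \<open>\<Phi>\<close>, as \<open>\<Phi>\<close> strictly lowers degrees and only generators of degree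
  at most \<open>c + 1\<close> occur, and \<open>\<delta>\<close> contributes a coboundary. Beyond \<open>\<tau>\<close> nothing arrives, because \<open>H\<close>
  consists of cocycles.\<close>

lemma dTot_Tot1_part_subset_Tot0_part: "dTot 0 ` Tot1_part \<tau> c \<subseteq> Tot0_part \<tau> c"
proof (rule image_subsetI)
  fix x assume x: "x \<in> Tot1_part \<tau> c"
  then have xV: "x \<in> Tot (Suc 0)" by (rule subsetD[OF Tot1_part_subset_Tot])
  have cx: "x j \<in> cell (Suc j) j" for j using Tot_column[OF xV, of j] by simp
  have x_high: "x j = 0" if "\<tau> < j" for j
  proof
    fix e show "x j e = 0 e"
    proof (cases "j \<le> n \<and> e \<in> B (Suc j)")
      case True
      then show ?thesis using coord_box_coordinate[OF x[unfolded Tot1_part_def], of j e] that by simp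
    next
      case False
      then show ?thesis using cell_beyond[OF _ cx[of j]] boxD(2)[OF cx[of j, unfolded cell_def], of e]
        by (cases "j \<le> n") auto
    qed
  qed
  have x_\<tau>: "x \<tau> e \<in> H \<tau> (- dg (Suc \<tau>) e)" "c + 1 < dg (Suc \<tau>) e \<Longrightarrow> x \<tau> e = 0" for e
  proof -
    have "x \<tau> e \<in> H \<tau> (- dg (Suc \<tau>) e) \<and> (c + 1 < dg (Suc \<tau>) e \<longrightarrow> x \<tau> e = 0)"
    proof (cases "\<tau> \<le> n \<and> e \<in> B (Suc \<tau>)")
      case True
      then show ?thesis using coord_box_coordinate[OF x[unfolded Tot1_part_def], of \<tau> e] subspace_0[OF subspace_H]
        by (simp add: Let_def split: if_splits)
    next
      case False
      then have "x \<tau> e = 0" using cell_beyond[OF _ cx[of \<tau>]] boxD(2)[OF cx[of \<tau>, unfolded cell_def], of e]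
        by (cases "\<tau> \<le> n") auto
      then show ?thesis using subspace_0[OF subspace_H] by simp
    qed
    then show "x \<tau> e \<in> H \<tau> (- dg (Suc \<tau>) e)" "c + 1 < dg (Suc \<tau>) e \<Longrightarrow> x \<tau> e = 0" by simp_all
  qed
  have \<delta>x_\<tau>: "\<delta> \<tau> \<circ> x \<tau> = 0"
    using subsetD[OF H_subset_cocyc x_\<tau>(1)] by (simp add: cocycles_def fun_eq_iff)
  show "dTot 0 x \<in> Tot0_part \<tau> c"
    unfolding Tot0_part_def
  proof (rule coord_boxI[OF dTot_in[OF xV]])
    fix j e assume j: "j \<le> n" and e: "e \<in> B (j + 0)"
    let ?d = "- dg (j + 0) e"
    have DE: "dTot 0 x j e \<in> E j ?d" using cell_coordinate[OF Tot_column[OF dTot_in[OF xV]]] .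
    consider "j < \<tau> \<or> j = \<tau> \<and> dg j e \<le> c" | "j = \<tau>" "c < dg j e" | "\<tau> < j" by linarith
    then show "dTot 0 x j e \<in> (let d = ?d in if j < \<tau> \<or> j = \<tau> \<and> dg (j + 0) e \<le> c then E j d
      else if j = \<tau> then sum_space (cobd j d) (C j d) else C j d)"
    proof cases
      case 1
      with DE show ?thesis by simp
    next
      case 2
      have "\<Phi> \<tau> (x \<tau>) e = 0"
      proof (rule ccontr)
        assume "\<Phi> \<tau> (x \<tau>) e \<noteq> 0"
        from \<Phi>_degree[OF cx this] obtain e' where "x \<tau> e' \<noteq> 0" "dg \<tau> e < dg (Suc \<tau>) e'" by blast
        moreover from this(2) have "c + 1 < dg (Suc \<tau>) e'" using 2 by simp
        ultimately show False using x_\<tau>(2)[of e'] by simp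
      qed
      moreover have "delta_shift x \<tau> e \<in> cobd \<tau> ?d"
      proof (cases \<tau>)
        case 0
        then show ?thesis by (simp add: coboundaries_def)
      next
        case (Suc k)
        then show ?thesis using cell_coordinate[OF cx[of k], of e] 2 by (simp add: coboundaries_def)
      qed
      ultimately have "dTot 0 x j e = delta_shift x \<tau> e + 0 \<and> delta_shift x \<tau> e \<in> cobd j ?d \<and> 0 \<in> C j ?d"
        using 2 subspace_0[OF subspace_C] by (simp add: dTot_def sign_twist_def)
      then have "dTot 0 x j e \<in> sum_space (cobd j ?d) (C j ?d)" by blast
      then show ?thesis using 2 by (simp add: Let_def)
    next
      case 3
      then obtain k where k: "j = Suc k" "\<tau> \<le> k" by (cases j) auto
      have "\<delta> k \<circ> x k = 0"
        using k(2) \<delta>x_\<tau> x_high[of k] by (cases "k = \<tau>") (auto simp: fun_eq_iff)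
      then have "dTot 0 x j = 0" using 3 k x_high[of j] by (simp add: dTot_def sign_twist_def)
      then show ?thesis using 3 subspace_0[OF subspace_C] by simp
    qed
  qed
qed

lemma dim_Tot1_part: "fn2.dim (Tot1_part \<tau> c) = (\<Sum>j\<le>n. \<Sum>e\<in>B (j + Suc 0). let d = - dg (j + Suc 0) e in
    if j < \<tau> then h j d + b (Suc j) d else if j = \<tau> \<and> dg (j + Suc 0) e \<le> c + 1 then h j d else 0)"
  and subspace_Tot1_part: "fn2.subspace (Tot1_part \<tau> c)"
proof -
  let ?Y = "\<lambda>j e. let d = - dg (j + Suc 0) e in
    if j < \<tau> then sum_space (H j d) (C j d)
    else if j = \<tau> \<and> dg (j + Suc 0) e \<le> c + 1 then H j d else {0}"
  have Y: "subspace (?Y j e)" "fin_dim (?Y j e)" for j e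
    using dim_H_plus_C subspace_H fin_dim_H fin_dim_singleton subspace_single_0 by (simp_all add: Let_def)
  show "fn2.subspace (Tot1_part \<tau> c)" unfolding Tot1_part_def by (rule subspace_coord_box[OF Y(1)])
  have dTot: "dim (?Y j e) = (let d = - dg (j + Suc 0) e in if j < \<tau> then h j d + b (Suc j) d
    else if j = \<tau> \<and> dg (j + Suc 0) e \<le> c + 1 then h j d else 0)" for j e
    using dim_H_plus_C(1)
    by (cases "j < \<tau>"; cases "j = \<tau>"; cases "dg (j + Suc 0) e \<le> c + 1") (simp_all add: Let_def h_def)
  show "fn2.dim (Tot1_part \<tau> c) = (\<Sum>j\<le>n. \<Sum>e\<in>B (j + Suc 0). let d = - dg (j + Suc 0) e in
    if j < \<tau> then h j d + b (Suc j) d else if j = \<tau> \<and> dg (j + Suc 0) e \<le> c + 1 then h j d else 0)"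
    unfolding Tot1_part_def dim_coord_box[OF Y] dTot ..
qed

lemma dim_Tot0_part: "fn2.dim (Tot0_part \<tau> c) = (\<Sum>j\<le>n. \<Sum>e\<in>B (j + 0). let d = - dg (j + 0) e in
    if j < \<tau> \<or> j = \<tau> \<and> dg (j + 0) e \<le> c then h j d + b j d + b (Suc j) d
    else if j = \<tau> then b j d + b (Suc j) d else b (Suc j) d)"
  and subspace_Tot0_part: "fn2.subspace (Tot0_part \<tau> c)" and fin_dim_Tot0_part: "fn2.fin_dim (Tot0_part \<tau> c)"
proof -
  let ?Y = "\<lambda>j e. let d = - dg (j + 0) e in
    if j < \<tau> \<or> j = \<tau> \<and> dg (j + 0) e \<le> c then E j d
    else if j = \<tau> then sum_space (cobd j d) (C j d) else C j d"
  have Y: "subspace (?Y j e)" "fin_dim (?Y j e)" for j e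
    using dim_cobd_plus_C subspace_C fin_dim_C subspace_E fin_dim_E by (simp_all add: Let_def)
  show "fn2.subspace (Tot0_part \<tau> c)" unfolding Tot0_part_def by (rule subspace_coord_box[OF Y(1)])
  show "fn2.fin_dim (Tot0_part \<tau> c)" unfolding Tot0_part_def by (rule fin_dim_coord_box[OF Y(2)])
  have dTot: "dim (?Y j e) = (let d = - dg (j + 0) e in
    if j < \<tau> \<or> j = \<tau> \<and> dg (j + 0) e \<le> c then h j d + b j d + b (Suc j) d
    else if j = \<tau> then b j d + b (Suc j) d else b (Suc j) d)" for j e
    using dim_cobd_plus_C(1)
    by (cases "j < \<tau>"; cases "j = \<tau>"; cases "dg (j + 0) e \<le> c") (simp_all add: Let_def dim_E dim_C)
  show "fn2.dim (Tot0_part \<tau> c) = (\<Sum>j\<le>n. \<Sum>e\<in>B (j + 0). let d = - dg (j + 0) e in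
    if j < \<tau> \<or> j = \<tau> \<and> dg (j + 0) e \<le> c then h j d + b j d + b (Suc j) d
    else if j = \<tau> then b j d + b (Suc j) d else b (Suc j) d)"
    unfolding Tot0_part_def dim_coord_box[OF Y] dTot ..
qed

definition Tot_C :: "nat \<Rightarrow> (nat \<Rightarrow> 'i \<Rightarrow> 'e) set"
  where "Tot_C p = coord_box p (\<lambda>j e. C j (- dg (j + p) e))"

lemma dim_Tot_C: "fn2.dim (Tot_C p) = (\<Sum>j\<le>n. csum p j)" and subspace_Tot_C: "fn2.subspace (Tot_C p)"
  unfolding Tot_C_def using dim_coord_box[OF subspace_C fin_dim_C] subspace_coord_box[OF subspace_C]
  by (simp_all add: csum_def dim_C)

lemma Tot_C_subset_Tot: "Tot_C p \<subseteq> Tot p"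
  unfolding Tot_C_def Tot_eq_coord_box by (rule coord_box_mono) (rule C_subset_E)

lemma Tot_C_subset_Tot0_part: "Tot_C 0 \<subseteq> Tot0_part \<tau> c"
  unfolding Tot_C_def Tot0_part_def
proof (rule coord_box_mono)
  fix j e
  let ?d = "- dg (j + 0) e"
  have "C j ?d \<subseteq> sum_space (cobd j ?d) (C j ?d)"
  proof
    fix x assume "x \<in> C j ?d"
    then have "x = 0 + x \<and> 0 \<in> cobd j ?d \<and> x \<in> C j ?d" using subspace_0[OF rank_nullity_\<delta>(3)] by simp
    then show "x \<in> sum_space (cobd j ?d) (C j ?d)" by blast
  qed
  then show "C j ?d \<subseteq> (let d = ?d in
    if j < \<tau> \<or> j = \<tau> \<and> dg (j + 0) e \<le> c then E j d
    else if j = \<tau> then sum_space (cobd j d) (C j d) else C j d)"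
    using C_subset_E[of j ?d]
    by (cases "j < \<tau>"; cases "j = \<tau>"; cases "dg (j + 0) e \<le> c") (simp_all add: Let_def)
qed

text \<open>The cycles \<open>dTot (Suc 0) ` Tot_C 2\<close> and the cycles in \<open>N = Tot1_part\<close> are independent subspaces of
  \<open>Z\<^sub>1\<close>. The former have the dimension of \<open>Tot_C 2\<close>; for the latter, \<open>dTot 0\<close> maps \<open>N\<close> to a
  subspace of \<open>Tot0_part\<close> that is independent of \<open>Tot_C 0\<close>, which bounds its rank.\<close>

lemma dimension_inequality:
  "fn2.dim (Tot_C (Suc (Suc 0))) + fn2.dim (Tot1_part \<tau> c) + fn2.dim (Tot_C 0) \<le> fn2.dim (Tot_cycles 0) + fn2.dim (Tot0_part \<tau> c)"
proof -
  let ?C2 = "Tot_C (Suc (Suc 0))" and ?K = "{x \<in> Tot1_part \<tau> c. dTot 0 x = 0}"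
  have C2_trivial: "x = 0" if "x \<in> ?C2" "dTot (Suc 0) x \<in> Tot1_part \<tau> c" for x
    using C_eq_0_if_boundary_in_H_plus_C that Tot1_part_subset_H_plus_C unfolding Tot_C_def by blast
  note N = rank_nullity_dTot[OF subspace_Tot1_part[of \<tau> c] Tot1_part_subset_Tot]
  note C2 = rank_nullity_dTot[OF subspace_Tot_C Tot_C_subset_Tot, of "Suc 0"]
  have D0: "dTot p 0 = 0" for p
  proof
    fix j
    have "delta_shift 0 j = 0" by (cases j) (simp_all add: fun_eq_iff)
    then show "dTot p 0 j = 0 j" by (simp add: dTot_def)
  qed
  have "{x \<in> ?C2. dTot (Suc 0) x = 0} = {0}"
    using C2_trivial fn2.subspace_0[OF subspace_Tot_C] fn2.subspace_0[OF subspace_Tot1_part] D0 by auto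
  then have dim_C2: "fn2.dim ?C2 = fn2.dim (dTot (Suc 0) ` ?C2)" using C2(1) by simp
  have "fn2.dim (dTot (Suc 0) ` ?C2) + fn2.dim ?K \<le> fn2.dim (Tot_cycles 0)"
  proof (rule fn2.dim_independent_subspaces_le[OF C2(3) N(2)])
    show "fn2.subspace (Tot_cycles 0)" "fn2.fin_dim (Tot_cycles 0)"
      unfolding Tot_cycles_def using rank_nullity_dTot(2)[OF subspace_Tot order_refl]
      by (auto intro: fn2.fin_dim_subset[OF fin_dim_Tot])
    show "dTot (Suc 0) ` ?C2 \<subseteq> Tot_cycles 0"
      using Tot_C_subset_Tot unfolding dTot_image_Tot[symmetric] by (rule image_mono)
    show "?K \<subseteq> Tot_cycles 0" unfolding Tot_cycles_def using Tot1_part_subset_Tot by auto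
    show "dTot (Suc 0) ` ?C2 \<inter> ?K \<subseteq> {0}" using C2_trivial D0 by auto
  qed
  moreover have "fn2.dim (dTot 0 ` Tot1_part \<tau> c) + fn2.dim (Tot_C 0) \<le> fn2.dim (Tot0_part \<tau> c)"
  proof (rule fn2.dim_independent_subspaces_le[OF N(3) subspace_Tot_C subspace_Tot0_part fin_dim_Tot0_part
        dTot_Tot1_part_subset_Tot0_part Tot_C_subset_Tot0_part])
    show "dTot 0 ` Tot1_part \<tau> c \<inter> Tot_C 0 \<subseteq> {0}"
    proof
      fix y assume "y \<in> dTot 0 ` Tot1_part \<tau> c \<inter> Tot_C 0"
      then obtain x where "x \<in> Tot1_part \<tau> c" "y = dTot 0 x" "dTot 0 x \<in> Tot_C 0" by auto
      then show "y \<in> {0}"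
        using boundary_in_C_eq_0[of x] subsetD[OF Tot1_part_subset_Tot] by (simp add: Tot_C_def)
    qed
  qed
  ultimately show ?thesis using dim_C2 N(1) by linarith
qed

text \<open>In \<open>dimension_inequality\<close> all contributions of \<open>B\<close> and \<open>C\<close> cancel: \<open>Tot_C 0\<close> is the \<open>C\<close>-part of
  \<open>Tot0_part\<close>, the spaces \<open>C'\<^sub>1\<close> and \<open>B'\<^sub>0\<close> have the same dimension by \<open>sum_bsum\<close>, and \<open>dim C\<^sub>2\<close> is
  the correction term in \<open>alternating_hsum\<close>.\<close>

theorem truncated_euler_characteristic_nonneg:
  assumes \<tau>: "\<tau> \<le> n" and vanish: "\<And>i e j. Q \<le> i \<Longrightarrow> e \<in> B i \<Longrightarrow> E j (- dg i e) = {0}"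
  shows "0 \<le> (\<Sum>q<Q. (-1) ^ q * int (\<Sum>j\<le>n. hsum (Suc (Suc q)) j))
    + (\<Sum>j<\<tau>. int (hsum 0 j) - int (hsum (Suc 0) j))
    + int (\<Sum>e\<in>{e \<in> B \<tau>. dg \<tau> e \<le> c}. h \<tau> (- dg \<tau> e))
    - int (\<Sum>e\<in>{e \<in> B (Suc \<tau>). dg (Suc \<tau>) e \<le> c + 1}. h \<tau> (- dg (Suc \<tau>) e))"
proof -
  let ?h0 = "\<Sum>e\<in>{e \<in> B \<tau>. dg \<tau> e \<le> c}. h \<tau> (- dg \<tau> e)"
  let ?h1 = "\<Sum>e\<in>{e \<in> B (Suc \<tau>). dg (Suc \<tau>) e \<le> c + 1}. h \<tau> (- dg (Suc \<tau>) e)"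
  have split: "(\<Sum>j\<le>n. f j) = (\<Sum>j<\<tau>. f j) + f \<tau> + (\<Sum>j\<in>{\<tau><..n}. f j)" for f :: "nat \<Rightarrow> nat"
  proof -
    have "{..n} = {..\<tau>} \<union> {\<tau><..n}" "{..\<tau>} \<inter> {\<tau><..n} = {}" using \<tau> by auto
    then show ?thesis by (simp add: sum.union_disjoint lessThan_Suc_atMost[symmetric])
  qed
  have "fn2.dim (Tot1_part \<tau> c) = (\<Sum>j<\<tau>. hsum (Suc 0) j + csum (Suc 0) j) + ?h1"
    unfolding dim_Tot1_part split
    by (simp add: Let_def hsum_def csum_def sum.distrib sum.inter_filter[OF finite_B, symmetric])
  moreover have "fn2.dim (Tot0_part \<tau> c) = (\<Sum>j<\<tau>. hsum 0 j + bsum 0 j + csum 0 j)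
      + (?h0 + bsum 0 \<tau> + csum 0 \<tau>) + (\<Sum>j\<in>{\<tau><..n}. csum 0 j)"
  proof -
    have "(\<Sum>e\<in>B \<tau>. let d = - dg \<tau> e in if dg \<tau> e \<le> c then h \<tau> d + b \<tau> d + b (Suc \<tau>) d
        else b \<tau> d + b (Suc \<tau>) d) = (\<Sum>e\<in>B \<tau>. (if dg \<tau> e \<le> c then h \<tau> (- dg \<tau> e) else 0)
          + b \<tau> (- dg \<tau> e) + b (Suc \<tau>) (- dg \<tau> e))"
      by (rule sum.cong) (simp_all add: Let_def)
    also have "\<dots> = ?h0 + bsum 0 \<tau> + csum 0 \<tau>"
      by (simp add: sum.distrib bsum_def csum_def sum.inter_filter[OF finite_B, symmetric])
    finally show ?thesis
      unfolding dim_Tot0_part split by (simp add: Let_def hsum_def bsum_def csum_def sum.distrib cong: if_cong)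
  qed
  moreover have "fn2.dim (Tot_C 0) = (\<Sum>j<\<tau>. csum 0 j) + csum 0 \<tau> + (\<Sum>j\<in>{\<tau><..n}. csum 0 j)"
    unfolding dim_Tot_C split ..
  moreover have "(\<Sum>j<\<tau>. bsum 0 j) + bsum 0 \<tau> = (\<Sum>j<\<tau>. csum (Suc 0) j)"
    using sum_bsum[of 0 \<tau>] by (simp add: lessThan_Suc_atMost[symmetric])
  ultimately have "(\<Sum>j\<le>n. csum (Suc (Suc 0)) j) + (\<Sum>j<\<tau>. hsum (Suc 0) j) + ?h1 \<le>
      fn2.dim (Tot_cycles 0) + (\<Sum>j<\<tau>. hsum 0 j) + ?h0"
    using dimension_inequality[of \<tau> c] unfolding dim_Tot_C[of "Suc (Suc 0)"] sum.distrib by linarith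
  moreover have "(\<Sum>j<\<tau>. int (hsum 0 j) - int (hsum (Suc 0) j)) =
      int (\<Sum>j<\<tau>. hsum 0 j) - int (\<Sum>j<\<tau>. hsum (Suc 0) j)"
    by (simp add: sum_subtractf)
  moreover have "int (fn2.dim (Tot_cycles 0)) = (\<Sum>q<Q. (-1) ^ q * int (\<Sum>j\<le>n. hsum (Suc (Suc q)) j))
      + int (\<Sum>j\<le>n. csum (Suc (Suc 0)) j)"
    by (rule alternating_hsum) (rule vanish)
  ultimately show ?thesis by linarith
qed

end

section \<open>Homogeneous polynomials\<close>

definition mdeg :: "('v::finite \<Rightarrow>\<^sub>0 nat) \<Rightarrow> int"
  where "mdeg m = (\<Sum>v\<in>UNIV. int (Poly_Mapping.lookup m v))"

lemma mdeg_add: "mdeg (m + m') = mdeg m + mdeg m'"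
  by (simp add: mdeg_def lookup_add sum.distrib)

lemma mdeg_nonneg: "0 \<le> mdeg m"
  by (simp add: mdeg_def sum_nonneg)

lemma mdeg_eq_0_iff: "mdeg m = 0 \<longleftrightarrow> m = 0"
proof
  assume "mdeg m = 0"
  then have "\<forall>v. Poly_Mapping.lookup m v = 0"
    unfolding mdeg_def by (subst (asm) sum_nonneg_eq_0_iff) auto
  then show "m = 0" by (intro poly_mapping_eqI) simp
qed (simp add: mdeg_def)

lemma finite_mdeg: "finite {m :: 'v::finite \<Rightarrow>\<^sub>0 nat. mdeg m = d}"
proof -
  let ?S = "{m :: 'v \<Rightarrow>\<^sub>0 nat. mdeg m = d}"
  have "Poly_Mapping.lookup ` ?S \<subseteq> UNIV \<rightarrow>\<^sub>E {..nat d}"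
  proof (rule image_subsetI)
    fix m :: "'v \<Rightarrow>\<^sub>0 nat" assume "m \<in> ?S"
    then have d: "(\<Sum>v\<in>UNIV. int (Poly_Mapping.lookup m v)) = d" by (simp add: mdeg_def)
    have "Poly_Mapping.lookup m v \<le> nat d" for v
    proof -
      have "int (Poly_Mapping.lookup m v) \<le> d"
        unfolding d[symmetric] by (rule member_le_sum) simp_all
      then show ?thesis by linarith
    qed
    then show "Poly_Mapping.lookup m \<in> UNIV \<rightarrow>\<^sub>E {..nat d}" by auto
  qed
  moreover have "finite (UNIV \<rightarrow>\<^sub>E {..nat d} :: ('v \<Rightarrow> nat) set)"
    by (rule finite_PiE) simp_all
  ultimately have "finite (Poly_Mapping.lookup ` ?S)" by (rule finite_subset)
  then show ?thesis
    by (rule finite_imageD) (rule inj_onI, rule poly_mapping_eqI, simp)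
qed

lemma homogeneous_iff: "homogeneous p d \<longleftrightarrow> (\<forall>m. Poly_Mapping.lookup p m \<noteq> 0 \<longrightarrow> mdeg m = d)"
  unfolding homogeneous_def mdeg_def Ball_def in_keys_iff ..

lemma homogeneous_single: "homogeneous (Poly_Mapping.single m a) (mdeg m)"
  by (simp add: homogeneous_iff lookup_single when_def)

lemma homogeneous_mconst: "homogeneous (mconst a) 0"
  using homogeneous_single[of 0 a] by (simp add: mconst_def mdeg_def)

lemma homogeneous_negative:
  assumes "homogeneous p d" "d < 0" shows "p = 0"
proof (rule poly_mapping_eqI)
  fix m show "Poly_Mapping.lookup p m = Poly_Mapping.lookup 0 m"
    using assms mdeg_nonneg[of m] unfolding homogeneous_iff by (metis lookup_zero not_less)
qed

lemma homogeneous_degree_0: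
  assumes "homogeneous p 0" "Poly_Mapping.lookup p 0 = 0" shows "p = 0"
proof (rule poly_mapping_eqI)
  fix m show "Poly_Mapping.lookup p m = Poly_Mapping.lookup 0 m"
    using assms mdeg_eq_0_iff[of m] by (cases "m = 0") (auto simp: homogeneous_iff)
qed

lemma mconst_1: "mconst 1 = 1"
  and mconst_add: "mconst (a + b) = mconst a + mconst b"
  and mconst_mult: "mconst (a * b) = mconst a * mconst b"
  by (simp_all add: mconst_def single_add mult_single)

lemma poly_mapping_sum_single:
  assumes "finite A" "Poly_Mapping.keys p \<subseteq> A"
  shows "(\<Sum>m\<in>A. Poly_Mapping.single m (Poly_Mapping.lookup p m)) = p"
proof (rule poly_mapping_eqI)
  fix k
  have "Poly_Mapping.lookup (\<Sum>m\<in>A. Poly_Mapping.single m (Poly_Mapping.lookup p m)) k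
      = (\<Sum>m\<in>A. if m = k then Poly_Mapping.lookup p m else 0)"
    by (simp add: lookup_sum lookup_single when_def)
  also have "\<dots> = Poly_Mapping.lookup p k"
    using assms by (auto simp: in_keys_iff)
  finally show "Poly_Mapping.lookup (\<Sum>m\<in>A. Poly_Mapping.single m (Poly_Mapping.lookup p m)) k
      = Poly_Mapping.lookup p k" .
qed

definition homogeneous_component :: "int \<Rightarrow> ('v::finite, 'k::field) mpoly \<Rightarrow> ('v, 'k) mpoly"
  where "homogeneous_component d p = (\<Sum>m\<in>{m \<in> Poly_Mapping.keys p. mdeg m = d}. Poly_Mapping.single m (Poly_Mapping.lookup p m))"

lemma lookup_homogeneous_component: "Poly_Mapping.lookup (homogeneous_component d p) k = (if mdeg k = d then Poly_Mapping.lookup p k else 0)"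
proof -
  have "Poly_Mapping.lookup (homogeneous_component d p) k = (\<Sum>m\<in>{m \<in> Poly_Mapping.keys p. mdeg m = d}. if m = k then Poly_Mapping.lookup p m else 0)"
    by (simp add: homogeneous_component_def lookup_sum lookup_single when_def)
  also have "\<dots> = (if mdeg k = d then Poly_Mapping.lookup p k else 0)"
    by (auto simp: in_keys_iff)
  finally show ?thesis .
qed

lemma homogeneous_homogeneous_component: "homogeneous (homogeneous_component d p) d"
  by (simp add: homogeneous_iff lookup_homogeneous_component)

text \<open>The shift by \<open>k\<close> allows for the degree of the basis element that \<open>p\<close> multiplies.\<close>

lemma sum_homogeneous_component:
  assumes "finite I" "\<And>m. m \<in> Poly_Mapping.keys p \<Longrightarrow> mdeg m + k \<in> I"
  shows "(\<Sum>D\<in>I. homogeneous_component (D - k) p) = p"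
proof (rule poly_mapping_eqI)
  fix m
  have "(\<Sum>D\<in>I. Poly_Mapping.lookup (homogeneous_component (D - k) p) m) = (\<Sum>D\<in>I. if D = mdeg m + k then Poly_Mapping.lookup p m else 0)"
    by (rule sum.cong) (auto simp: lookup_homogeneous_component)
  also have "\<dots> = Poly_Mapping.lookup p m"
    using assms by (auto simp: in_keys_iff)
  finally show "Poly_Mapping.lookup (\<Sum>D\<in>I. homogeneous_component (D - k) p) m = Poly_Mapping.lookup p m"
    by (simp add: lookup_sum)
qed

lemma vector_space_mconst:
  assumes "module s" shows "vector_space (\<lambda>a. s (mconst a))"
proof -
  interpret module s by fact
  show ?thesis
    by unfold_locales (simp_all add: mconst_add mconst_mult mconst_1 algebra_simps)
qed

section \<open>Graded modules with a homogeneous basis\<close>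

context graded_module
begin

lemma neg_comp:
  assumes "x \<in> G d" shows "- x \<in> G d"
proof -
  have "s (mconst (- 1)) x \<in> G (0 + d)" by (rule scale_comp[OF homogeneous_mconst assms])
  moreover have "s (mconst (- 1)) x = - x"
    by (simp add: mconst_def single_uminus)
  ultimately show ?thesis by simp
qed

lemma diff_comp: "x \<in> G d \<Longrightarrow> y \<in> G d \<Longrightarrow> x - y \<in> G d"
  using add_comp[of x d "- y"] neg_comp[of y d] by simp

lemma sum_comp: "(\<And>i. i \<in> I \<Longrightarrow> f i \<in> G d) \<Longrightarrow> sum f I \<in> G d"
  by (induction I rule: infinite_finite_induct) (simp_all add: zero_comp add_comp)

lemma sum_homogeneous_eq_0:
  assumes "finite I" "\<And>d. d \<in> I \<Longrightarrow> f d \<in> G d" "(\<Sum>d\<in>I. f d) = 0" "d \<in> I"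
  shows "f d = 0"
proof -
  define g where "g d = (if d \<in> I then f d else 0)" for d
  have "g d = 0"
  proof (rule direct)
    show "g d \<in> G d" for d using assms(2) zero_comp by (simp add: g_def)
    have sub: "{d. g d \<noteq> 0} \<subseteq> I" by (auto simp: g_def)
    then show "finite {d. g d \<noteq> 0}" using assms(1) by (rule finite_subset)
    have "(\<Sum>d | g d \<noteq> 0. g d) = (\<Sum>d\<in>I. g d)"
      using assms(1) sub by (intro sum.mono_neutral_left) auto
    then show "(\<Sum>d | g d \<noteq> 0. g d) = 0" using assms(3) by (simp add: g_def)
  qed
  then show ?thesis using assms(4) by (simp add: g_def)
qed

lemma homogeneous_degree_unique:
  assumes "x \<in> G d" "x \<in> G e" "x \<noteq> 0" shows "d = e"
proof (rule ccontr)
  assume de: "d \<noteq> e"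
  have "(if d = d then x else - x) = 0"
  proof (rule sum_homogeneous_eq_0[of "{d, e}" "\<lambda>i. if i = d then x else - x"])
    show "(if i = d then x else - x) \<in> G i" if "i \<in> {d, e}" for i
      using that assms neg_comp by auto
    show "(\<Sum>i\<in>{d, e}. if i = d then x else - x) = 0" using de by simp
  qed simp_all
  then show False using assms(3) by simp
qed

lemma comp_subset_total: "G d \<subseteq> total s G"
  unfolding total_def using span_superset by blast

end

text \<open>A fixed finite homogeneous basis turns statements about the module into statements about
  coefficients, for which \<^const>\<open>module.representation\<close> is available.\<close>

locale graded_free = graded_module s G
  for s :: "('v::finite, 'k::field) mpoly \<Rightarrow> 'm::ab_group_add \<Rightarrow> 'm" and G :: "int \<Rightarrow> 'm set" +
  fixes B :: "'m set"
  assumes finite_basis: "finite B" and basis: "homogeneous_basis s G B"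
begin

lemma independent_basis: "independent B" and span_basis: "span B = total s G"
  using basis by (simp_all add: homogeneous_basis_def)

definition dg :: "'m \<Rightarrow> int" where "dg b = (THE d. b \<in> G d)"

lemma basis_nonzero: "b \<in> B \<Longrightarrow> b \<noteq> 0"
  using independent_basis dependent_zero by blast

lemma basis_degree: assumes "b \<in> B" shows "b \<in> G d \<longleftrightarrow> d = dg b"
proof -
  obtain e where e: "b \<in> G e" using basis assms unfolding homogeneous_basis_def by blast
  then have "dg b = e" unfolding dg_def
    using homogeneous_degree_unique basis_nonzero[OF assms] by blast
  then show ?thesis using e homogeneous_degree_unique[OF e _ basis_nonzero[OF assms]] by blast
qed

lemma basis_in: "b \<in> B \<Longrightarrow> b \<in> G (dg b)"
  using basis_degree by blast

abbreviation rep :: "'m \<Rightarrow> 'm \<Rightarrow> ('v, 'k) mpoly"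
  where "rep \<equiv> representation B"

lemma rep_outside: "b \<notin> B \<Longrightarrow> rep x b = 0"
  using representation_ne_zero by blast

lemma sum_rep: "x \<in> total s G \<Longrightarrow> (\<Sum>b\<in>B. s (rep x b) b) = x"
  using sum_representation_eq[OF independent_basis _ finite_basis order_refl] span_basis by blast

lemma combination_in_total: "(\<Sum>b\<in>B. s (c b) b) \<in> total s G"
  unfolding span_basis[symmetric] by (intro span_sum span_scale span_base)

lemma rep_unique:
  assumes "(\<Sum>b\<in>B. s (c b) b) = x" "b \<in> B" shows "rep x b = c b"
proof -
  have x: "x \<in> total s G" using combination_in_total assms(1) by blast
  have "(\<Sum>b\<in>B. s (rep x b - c b) b) = 0"
    using sum_rep[OF x] assms(1) by (simp add: scale_left_diff_distrib sum_subtractf)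
  from independentD[OF independent_basis finite_basis order_refl this assms(2)]
  show ?thesis by simp
qed

lemma rep_add: "x \<in> total s G \<Longrightarrow> y \<in> total s G \<Longrightarrow> rep (x + y) b = rep x b + rep y b"
  using representation_add[OF independent_basis] span_basis by (simp add: fun_eq_iff)

lemma rep_scale: "x \<in> total s G \<Longrightarrow> rep (s p x) b = p * rep x b"
  using representation_scale[OF independent_basis] span_basis by (simp add: fun_eq_iff)

lemma rep_sum:
  assumes "\<And>i. i \<in> I \<Longrightarrow> f i \<in> total s G"
  shows "rep (sum f I) b = (\<Sum>i\<in>I. rep (f i) b)"
proof -
  have "rep (sum f I) = (\<lambda>b. \<Sum>i\<in>I. rep (f i) b)"
    by (rule representation_sum[OF independent_basis]) (simp add: span_basis assms)
  then show ?thesis by simp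
qed

lemma rep_0: "rep 0 b = 0"
  by (simp add: representation_zero)

lemma homogeneous_combination:
  "(\<And>b. b \<in> B \<Longrightarrow> homogeneous (c b) (d - dg b)) \<Longrightarrow> (\<Sum>b\<in>B. s (c b) b) \<in> G d"
  using scale_comp[OF _ basis_in] by (intro sum_comp) fastforce

text \<open>Splitting the coefficients into homogeneous components splits a linear combination into its
  homogeneous components. The degree \<open>d\<close> is added to the index set so that it can be singled out
  when components are compared.\<close>

lemma homogeneous_decomposition:
  obtains I where "finite I" "(\<Sum>D\<in>I. \<Sum>b\<in>B. s (homogeneous_component (D - dg b) (c b)) b) = (\<Sum>b\<in>B. s (c b) b)"
    "d \<in> I"
proof -
  let ?I = "insert d (\<Union>b\<in>B. (\<lambda>m. mdeg m + dg b) ` Poly_Mapping.keys (c b))"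
  have fin: "finite ?I" using finite_basis by simp
  have "(\<Sum>D\<in>?I. \<Sum>b\<in>B. s (homogeneous_component (D - dg b) (c b)) b) = (\<Sum>b\<in>B. \<Sum>D\<in>?I. s (homogeneous_component (D - dg b) (c b)) b)"
    by (rule sum.swap)
  also have "\<dots> = (\<Sum>b\<in>B. s (\<Sum>D\<in>?I. homogeneous_component (D - dg b) (c b)) b)"
    by (simp only: scale_sum_left)
  also have "\<dots> = (\<Sum>b\<in>B. s (c b) b)"
  proof (rule sum.cong[OF refl])
    fix b assume "b \<in> B"
    then have "(\<Sum>D\<in>?I. homogeneous_component (D - dg b) (c b)) = c b" by (intro sum_homogeneous_component[OF fin]) blast
    then show "s (\<Sum>D\<in>?I. homogeneous_component (D - dg b) (c b)) b = s (c b) b" by simp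
  qed
  finally show thesis using that[of ?I] fin by blast
qed

text \<open>As the module is the direct sum of its components, \<open>x\<close> equals its component of degree \<open>d\<close>, whose
  coefficients are homogeneous; and coefficients are unique.\<close>

lemma rep_homogeneous:
  assumes x: "x \<in> G d" and b: "b \<in> B" shows "homogeneous (rep x b) (d - dg b)"
proof -
  let ?c = "rep x"
  let ?x = "\<lambda>D. \<Sum>b\<in>B. s (homogeneous_component (D - dg b) (?c b)) b"
  have xt: "x \<in> total s G" using x comp_subset_total by blast
  obtain I where I: "finite I" "(\<Sum>D\<in>I. ?x D) = (\<Sum>b\<in>B. s (?c b) b)" "d \<in> I"
    using homogeneous_decomposition[where c = ?c and d = d] .
  have "?x d - (if d = d then x else 0) = 0"
  proof (rule sum_homogeneous_eq_0[OF I(1) _ _ I(3), of "\<lambda>D. ?x D - (if D = d then x else 0)"])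
    show "?x D - (if D = d then x else 0) \<in> G D" for D
      using x zero_comp by (intro diff_comp homogeneous_combination homogeneous_homogeneous_component) simp
    show "(\<Sum>D\<in>I. ?x D - (if D = d then x else 0)) = 0"
      using I sum_rep[OF xt] by (simp add: sum_subtractf)
  qed
  then have "(\<Sum>b\<in>B. s (homogeneous_component (d - dg b) (?c b)) b) = x" by simp
  from rep_unique[OF this b] have "rep x b = homogeneous_component (d - dg b) (rep x b)" .
  then show ?thesis by (metis homogeneous_homogeneous_component)
qed

text \<open>Below the smallest degree of a basis element all coefficients would be homogeneous of negative
  degree.\<close>

lemma bounded_below: obtains L where "\<And>d. d < L \<Longrightarrow> G d = {0}"
proof -
  obtain L where L: "\<And>b. b \<in> B \<Longrightarrow> L \<le> dg b"
    using finite_basis Min_le[of "dg ` B"] by (metis finite_imageI imageI)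
  have "x = 0" if "d < L" "x \<in> G d" for d x
  proof -
    have "rep x b = 0" if "b \<in> B" for b
      using rep_homogeneous[OF \<open>x \<in> G d\<close> that] homogeneous_negative[of "rep x b"] L[OF that] \<open>d < L\<close>
      by simp
    then show ?thesis using sum_rep[of x] that(2) comp_subset_total by force
  qed
  then have "G d = {0}" if "d < L" for d using that zero_comp by blast
  then show thesis using that by blast
qed

text \<open>The products of basis elements with monomials of the complementary degree span, and there are only
  finitely many of them.\<close>

lemma fin_dim_comp: "vector_space.fin_dim (\<lambda>a. s (mconst a)) (G d)"
proof -
  interpret K: vector_space "\<lambda>a. s (mconst a)" by (rule vector_space_mconst) unfold_locales
  let ?S = "\<Union>b\<in>B. (\<lambda>m. s (Poly_Mapping.single m 1) b) ` {m. mdeg m = d - dg b}"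
  have "x \<in> K.span ?S" if x: "x \<in> G d" for x
  proof -
    have "s (rep x b) b \<in> K.span ?S" if b: "b \<in> B" for b
    proof -
      let ?M = "{m. mdeg m = d - dg b}"
      have sub: "Poly_Mapping.keys (rep x b) \<subseteq> ?M"
        using rep_homogeneous[OF x b] by (auto simp: homogeneous_iff in_keys_iff)
      have "s (rep x b) b = s (\<Sum>m\<in>?M. Poly_Mapping.single m (Poly_Mapping.lookup (rep x b) m)) b"
        by (simp only: poly_mapping_sum_single[OF finite_mdeg sub])
      also have "\<dots> = (\<Sum>m\<in>?M. s (mconst (Poly_Mapping.lookup (rep x b) m)) (s (Poly_Mapping.single m 1) b))"
        by (simp add: scale_sum_left mconst_def mult_single)
      also have "\<dots> \<in> K.span ?S"
        by (intro K.span_sum K.span_scale K.span_base) (use b in blast)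
      finally show ?thesis .
    qed
    then have "(\<Sum>b\<in>B. s (rep x b) b) \<in> K.span ?S" by (rule K.span_sum)
    then show ?thesis using sum_rep[of x] x comp_subset_total by force
  qed
  moreover have "finite ?S" using finite_basis finite_mdeg by blast
  ultimately show ?thesis unfolding K.fin_dim_def by blast
qed

lemma subspace_comp: "module.subspace (\<lambda>a. s (mconst a)) (G d)"
proof -
  interpret K: vector_space "\<lambda>a. s (mconst a)" by (rule vector_space_mconst) unfold_locales
  show ?thesis
    using scale_comp[OF homogeneous_mconst] by (intro K.subspaceI zero_comp add_comp) auto
qed

end

section \<open>Graded maps between free modules and the double complex of a resolution\<close>

context graded_free
begin

text \<open>The elements whose coefficients have no constant term form a submodule. Minimality of a resolution
  is always used in this form.\<close>

lemma constant_coefficient_maximal_ideal: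
  assumes "y \<in> span {s (mvar v) x | v x. x \<in> total s G}"
  shows "Poly_Mapping.lookup (rep y e) 0 = 0"
proof -
  let ?S = "{y \<in> total s G. \<forall>e. Poly_Mapping.lookup (rep y e) 0 = 0}"
  have mult: "Poly_Mapping.lookup (p * q) 0 = 0" if q: "Poly_Mapping.lookup q 0 = 0" for p q :: "('v, 'k) mpoly"
  proof (rule ccontr)
    assume "Poly_Mapping.lookup (p * q) 0 \<noteq> 0"
    then have "0 \<in> Poly_Mapping.keys (p * q)" by (simp add: in_keys_iff)
    then obtain a b where ab: "0 = a + b" "b \<in> Poly_Mapping.keys q"
      using keys_mult[of p q] by auto
    then have "mdeg a + mdeg b = 0" by (metis mdeg_add mdeg_eq_0_iff)
    then have "b = 0" using mdeg_nonneg[of a] mdeg_nonneg[of b] mdeg_eq_0_iff[of b] by linarith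
    then show False using ab(2) q by (simp add: in_keys_iff)
  qed
  have total: "subspace (total s G)" unfolding span_basis[symmetric] by simp
  have "span {s (mvar v) x | v x. x \<in> total s G} \<subseteq> ?S"
  proof (rule span_minimal)
    show "{s (mvar v) x | v x. x \<in> total s G} \<subseteq> ?S"
    proof clarify
      fix v x assume x: "x \<in> total s G"
      have "Poly_Mapping.lookup (mvar v :: ('v, 'k) mpoly) 0 = 0"
      proof -
        have "Poly_Mapping.single v (1::nat) \<noteq> 0"
          by (metis lookup_single_eq lookup_zero zero_neq_one)
        then show ?thesis by (simp add: mvar_def lookup_single when_def)
      qed
      then have "Poly_Mapping.lookup (rep x e * mvar v) 0 = 0" for e by (rule mult)
      then show "s (mvar v) x \<in> total s G \<and> (\<forall>e. Poly_Mapping.lookup (rep (s (mvar v) x) e) 0 = 0)"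
        using x subspace_scale[OF total] by (simp add: rep_scale mult.commute)
    qed
    show "subspace ?S"
    proof (rule subspaceI)
      show "0 \<in> ?S" using subspace_0[OF total] by (simp add: rep_0)
      show "x + y \<in> ?S" if "x \<in> ?S" "y \<in> ?S" for x y
        using that subspace_add[OF total] by (simp add: rep_add lookup_add)
      show "s p x \<in> ?S" if "x \<in> ?S" for p x
        using that subspace_scale[OF total] by (simp add: rep_scale mult)
    qed
  qed
  then show ?thesis using assms by blast
qed

end

locale graded_free_hom = dom: graded_free s G B + cod: graded_free t H C
  for s :: "('v::finite, 'k::field) mpoly \<Rightarrow> 'm::ab_group_add \<Rightarrow> 'm" and G B
    and t :: "('v, 'k) mpoly \<Rightarrow> 'n::ab_group_add \<Rightarrow> 'n" and H C +
  fixes f :: "'m \<Rightarrow> 'n"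
  assumes hom: "graded_hom s G t H f"
begin

lemma map_add: "x \<in> total s G \<Longrightarrow> y \<in> total s G \<Longrightarrow> f (x + y) = f x + f y"
  and map_scale: "x \<in> total s G \<Longrightarrow> f (s p x) = t p (f x)"
  and map_comp: "x \<in> G d \<Longrightarrow> f x \<in> H d"
  using hom by (simp_all add: graded_hom_def image_subset_iff)

lemma map_0: "f 0 = 0"
proof -
  have "0 \<in> total s G" using dom.span_zero dom.span_basis by blast
  from map_scale[OF this, of 0] show ?thesis by simp
qed

lemma map_sum: "(\<And>i. i \<in> I \<Longrightarrow> g i \<in> total s G) \<Longrightarrow> f (sum g I) = (\<Sum>i\<in>I. f (g i))"
proof (induction I rule: infinite_finite_induct)
  case (insert i I)
  have "sum g I \<in> dom.span B" using insert.prems dom.span_basis by (intro dom.span_sum) auto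
  then show ?case using insert map_add[of "g i" "sum g I"] dom.span_basis by simp
qed (simp_all add: map_0)

lemma basis_in_total: "b \<in> B \<Longrightarrow> b \<in> total s G"
  using dom.span_basis dom.span_base by blast

lemma map_combination: "f (\<Sum>b\<in>B. s (c b) b) = (\<Sum>b\<in>B. t (c b) (f b))"
proof -
  have "s (c b) b \<in> total s G" if "b \<in> B" for b
    using that dom.span_basis by (metis dom.span_base dom.span_scale)
  then have "f (\<Sum>b\<in>B. s (c b) b) = (\<Sum>b\<in>B. f (s (c b) b))" by (rule map_sum)
  then show ?thesis using map_scale[OF basis_in_total] by simp
qed

lemma map_basis_in: "b \<in> B \<Longrightarrow> f b \<in> H (dom.dg b)"
  using map_comp[OF dom.basis_in] .

lemma map_basis_total: "b \<in> B \<Longrightarrow> f b \<in> total t H"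
  using map_basis_in cod.comp_subset_total by blast

lemma map_total: "x \<in> total s G \<Longrightarrow> f x \<in> total t H"
proof -
  assume x: "x \<in> total s G"
  have "(\<Sum>b\<in>B. t (dom.rep x b) (f b)) \<in> cod.span C"
    using map_basis_total cod.span_basis by (intro cod.span_sum cod.span_scale) auto
  then show ?thesis using map_combination[of "dom.rep x"] dom.sum_rep[OF x] cod.span_basis by simp
qed

definition mat :: "'n \<Rightarrow> 'm \<Rightarrow> ('v, 'k) mpoly" where "mat e b = cod.rep (f b) e"

lemma mat_outside: "e \<notin> C \<Longrightarrow> mat e b = 0"
  unfolding mat_def by (rule cod.rep_outside)

lemma mat_homogeneous: "b \<in> B \<Longrightarrow> e \<in> C \<Longrightarrow> homogeneous (mat e b) (dom.dg b - cod.dg e)"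
  unfolding mat_def by (rule cod.rep_homogeneous[OF map_basis_in])

lemma rep_map:
  assumes "x \<in> total s G" shows "cod.rep (f x) e = (\<Sum>b\<in>B. dom.rep x b * mat e b)"
proof -
  have tot: "t p (f b) \<in> total t H" if "b \<in> B" for b p
    using map_basis_total[OF that] cod.span_basis by (metis cod.span_scale)
  have "cod.rep (f x) e = cod.rep (\<Sum>b\<in>B. t (dom.rep x b) (f b)) e"
    using map_combination[of "dom.rep x"] dom.sum_rep[OF assms] by simp
  also have "\<dots> = (\<Sum>b\<in>B. cod.rep (t (dom.rep x b) (f b)) e)"
    by (rule cod.rep_sum) (rule tot)
  also have "\<dots> = (\<Sum>b\<in>B. dom.rep x b * mat e b)"
    using cod.rep_scale[OF map_basis_total] by (simp add: mat_def)
  finally show ?thesis .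
qed

text \<open>The component of degree \<open>d\<close> of any preimage is a preimage too, because \<open>f\<close> preserves degrees and
  the target is the direct sum of its components.\<close>

lemma homogeneous_preimage:
  assumes y: "y \<in> H d" and w: "w \<in> total s G" "f w = y"
  shows "\<exists>w'\<in>G d. f w' = y"
proof -
  let ?w = "\<lambda>D. \<Sum>b\<in>B. s (homogeneous_component (D - dom.dg b) (dom.rep w b)) b"
  obtain I where I: "finite I" "(\<Sum>D\<in>I. ?w D) = (\<Sum>b\<in>B. s (dom.rep w b) b)" "d \<in> I"
    using dom.homogeneous_decomposition[where c = "dom.rep w" and d = d] .
  have wG: "?w D \<in> G D" for D by (intro dom.homogeneous_combination homogeneous_homogeneous_component)
  have "(\<Sum>D\<in>I. f (?w D)) = f (\<Sum>D\<in>I. ?w D)"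
    by (rule map_sum[symmetric]) (rule subsetD[OF dom.comp_subset_total wG])
  also have "\<dots> = y" unfolding I(2) dom.sum_rep[OF w(1)] by (rule w(2))
  finally have fw: "(\<Sum>D\<in>I. f (?w D)) = y" .
  have "f (?w d) - (if d = d then y else 0) = 0"
  proof (rule cod.sum_homogeneous_eq_0[OF I(1) _ _ I(3), of "\<lambda>D. f (?w D) - (if D = d then y else 0)"])
    show "f (?w D) - (if D = d then y else 0) \<in> H D" for D
      using y cod.zero_comp by (intro cod.diff_comp map_comp[OF wG]) simp
    show "(\<Sum>D\<in>I. f (?w D) - (if D = d then y else 0)) = 0"
      using I fw by (simp add: sum_subtractf)
  qed
  then show ?thesis using wG[of d] by auto
qed

text \<open>The entry is homogeneous of degree \<open>dom.dg b - cod.dg e\<close>. This degree is not negative, since the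
  entry is nonzero, and not zero, since by minimality the entry has no constant term.\<close>

lemma minimal_mat_degree:
  assumes min: "f ` total s G \<subseteq> cod.span {t (mvar v) x | v x. x \<in> total t H}"
    and b: "b \<in> B" and e: "mat e b \<noteq> 0"
  shows "e \<in> C" and "cod.dg e < dom.dg b"
proof -
  show eC: "e \<in> C" using e mat_outside by blast
  have "f b \<in> cod.span {t (mvar v) x | v x. x \<in> total t H}" using min basis_in_total[OF b] by blast
  then have "Poly_Mapping.lookup (mat e b) 0 = 0"
    unfolding mat_def by (rule cod.constant_coefficient_maximal_ideal)
  then show "cod.dg e < dom.dg b"
    using e mat_homogeneous[OF b eC] homogeneous_degree_0[of "mat e b"]
      homogeneous_negative[of "mat e b" "dom.dg b - cod.dg e"]
    by (cases "dom.dg b - cod.dg e" "0 :: int" rule: linorder_cases) auto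
qed

end

locale complex_and_resolution =
  fixes sE :: "('v::finite, 'k::field) mpoly \<Rightarrow> 'e::ab_group_add \<Rightarrow> 'e"
    and E :: "nat \<Rightarrow> int \<Rightarrow> 'e set" and \<delta> :: "nat \<Rightarrow> 'e \<Rightarrow> 'e" and n :: nat and A :: "nat \<Rightarrow> 'e set"
    and sF :: "('v, 'k) mpoly \<Rightarrow> 'f::ab_group_add \<Rightarrow> 'f"
    and F :: "nat \<Rightarrow> int \<Rightarrow> 'f set" and \<phi> :: "nat \<Rightarrow> 'f \<Rightarrow> 'f" and B :: "nat \<Rightarrow> 'f set"
  assumes E_free: "graded_free sE (E j) (A j)"
    and E_beyond: "n < j \<Longrightarrow> E j d = {0}"
    and \<delta>_hom: "graded_hom sE (E j) sE (E (Suc j)) (\<delta> j)"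
    and \<delta>_\<delta>: "x \<in> total sE (E j) \<Longrightarrow> \<delta> (Suc j) (\<delta> j x) = 0"
    and F_free: "graded_free sF (F i) (B i)"
    and \<phi>_hom: "graded_hom sF (F (Suc i)) sF (F i) (\<phi> i)"
    and \<phi>_exact: "\<phi> (Suc i) ` total sF (F (Suc (Suc i))) = {x \<in> total sF (F (Suc i)). \<phi> i x = 0}"
    and \<phi>_minimal: "\<phi> i ` total sF (F (Suc i)) \<subseteq> module.span sF {sF (mvar v) x | v x. x \<in> total sF (F i)}"
begin

sublocale E: graded_free sE "E j" "A j" for j by (rule E_free)
sublocale F: graded_free sF "F i" "B i" for i by (rule F_free)
sublocale \<delta>: graded_free_hom sE "E j" "A j" sE "E (Suc j)" "A (Suc j)" "\<delta> j" for j
  by unfold_locales (rule \<delta>_hom)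
sublocale \<phi>: graded_free_hom sF "F (Suc i)" "B (Suc i)" sF "F i" "B i" "\<phi> i" for i
  by unfold_locales (rule \<phi>_hom)

abbreviation Ksc :: "'k \<Rightarrow> 'e \<Rightarrow> 'e" where "Ksc \<equiv> \<lambda>a. sE (mconst a)"

text \<open>The map \<open>\<phi> i \<otimes> 1\<close> on \<open>F\<^sub>i\<^sub>+\<^sub>1 \<otimes> E\<^sup>j\<close> in coordinates with respect to the bases \<open>B\<close>: multiplication with
  the matrix of \<open>\<phi> i\<close>.\<close>

definition \<Phi> :: "nat \<Rightarrow> ('f \<Rightarrow> 'e) \<Rightarrow> 'f \<Rightarrow> 'e"
  where "\<Phi> i u e = (\<Sum>b\<in>B (Suc i). sE (\<phi>.mat i e b) (u b))"

definition cell :: "nat \<Rightarrow> nat \<Rightarrow> ('f \<Rightarrow> 'e) set"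
  where "cell i j = box (B i) (\<lambda>e. E j (- F.dg i e))"

lemma cell_in: "u \<in> cell i j \<Longrightarrow> b \<in> B i \<Longrightarrow> u b \<in> E j (- F.dg i b)"
  unfolding cell_def by (rule boxD(1))

lemma cell_outside: "u \<in> cell i j \<Longrightarrow> b \<notin> B i \<Longrightarrow> u b = 0"
  unfolding cell_def by (rule boxD(2))

lemma cell_total: "u \<in> cell i j \<Longrightarrow> b \<in> B i \<Longrightarrow> u b \<in> total sE (E j)"
  using cell_in E.comp_subset_total by blast

lemma \<Phi>_in: assumes u: "u \<in> cell (Suc i) j" shows "\<Phi> i u \<in> cell i j"
  unfolding cell_def
proof (rule boxI)
  fix e assume e: "e \<in> B i"
  have "sE (\<phi>.mat i e b) (u b) \<in> E j (- F.dg i e)" if b: "b \<in> B (Suc i)" for b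
    using E.scale_comp[OF \<phi>.mat_homogeneous[OF b e] cell_in[OF u b]] by simp
  then show "\<Phi> i u e \<in> E j (- F.dg i e)" unfolding \<Phi>_def by (rule E.sum_comp)
next
  fix e assume "e \<notin> B i"
  then show "\<Phi> i u e = 0" by (simp add: \<Phi>_def \<phi>.mat_outside)
qed

lemma mat_mat:
  assumes b: "b \<in> B (Suc (Suc i))"
  shows "(\<Sum>b'\<in>B (Suc i). \<phi>.mat i e b' * \<phi>.mat (Suc i) b' b) = 0"
proof -
  have "\<phi> (Suc i) b \<in> {x \<in> total sF (F (Suc i)). \<phi> i x = 0}"
    unfolding \<phi>_exact[symmetric] using \<phi>.basis_in_total[OF b] by (rule imageI)
  then have "F.rep i (\<phi> i (\<phi> (Suc i) b)) e = 0" by (simp add: F.rep_0)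
  then show ?thesis
    unfolding \<phi>.rep_map[OF \<phi>.map_basis_total[OF b]] by (simp add: \<phi>.mat_def mult.commute)
qed

lemma \<Phi>_\<Phi>: "\<Phi> i (\<Phi> (Suc i) u) = 0"
proof
  fix e
  have "\<Phi> i (\<Phi> (Suc i) u) e = (\<Sum>b'\<in>B (Suc i). \<Sum>b\<in>B (Suc (Suc i)).
      sE (\<phi>.mat i e b' * \<phi>.mat (Suc i) b' b) (u b))"
    by (simp add: \<Phi>_def E.scale_sum_right)
  also have "\<dots> = (\<Sum>b\<in>B (Suc (Suc i)). sE (\<Sum>b'\<in>B (Suc i). \<phi>.mat i e b' * \<phi>.mat (Suc i) b' b) (u b))"
    by (subst sum.swap) (simp add: E.scale_sum_left)
  also have "\<dots> = 0" by (simp add: mat_mat)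
  finally show "\<Phi> i (\<Phi> (Suc i) u) e = 0 e" by simp
qed

text \<open>Freeness of \<open>E\<^sup>j\<close> is used here. With a basis \<open>A j\<close> of \<open>E\<^sup>j\<close>, the space \<open>F\<^sub>i \<otimes> E\<^sup>j\<close> is a sum of
  copies of \<open>F\<^sub>i\<close>, one for each \<open>g \<in> A j\<close>, and the components of the given element in these copies can be lifted
  separately.\<close>

lemma \<Phi>_exact:
  assumes u: "u \<in> cell (Suc i) j" and 0: "\<Phi> i u = 0"
  shows "\<exists>w\<in>cell (Suc (Suc i)) j. \<Phi> (Suc i) w = u"
proof -
  let ?q = "\<lambda>b g. E.rep j (u b) g"
  let ?y = "\<lambda>g. \<Sum>b\<in>B (Suc i). sF (?q b g) b"
  have q: "homogeneous (?q b g) (- F.dg (Suc i) b - E.dg j g)" if "b \<in> B (Suc i)" "g \<in> A j" for b g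
    by (rule E.rep_homogeneous[OF cell_in[OF u that(1)] that(2)])
  have y: "?y g \<in> F (Suc i) (- E.dg j g)" if g: "g \<in> A j" for g
  proof (rule F.homogeneous_combination)
    fix b assume "b \<in> B (Suc i)"
    from q[OF this g] show "homogeneous (?q b g) (- E.dg j g - F.dg (Suc i) b)"
      by (subst minus_diff_commute)
  qed
  have y_total: "?y g \<in> total sF (F (Suc i))" for g by (rule F.combination_in_total)
  have rep_y: "F.rep (Suc i) (?y g) b = ?q b g" if "b \<in> B (Suc i)" for b g
    by (rule F.rep_unique[OF refl that])
  have "\<phi> i (?y g) = 0" for g
  proof -
    have "F.rep i (\<phi> i (?y g)) e = 0" for e
    proof -
      have "F.rep i (\<phi> i (?y g)) e = (\<Sum>b\<in>B (Suc i). \<phi>.mat i e b * ?q b g)"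
        unfolding \<phi>.rep_map[OF y_total] by (simp add: rep_y mult.commute)
      also have "\<dots> = E.rep j (\<Sum>b\<in>B (Suc i). sE (\<phi>.mat i e b) (u b)) g"
      proof -
        have tot: "sE p (u b) \<in> total sE (E j)" if "b \<in> B (Suc i)" for b p
          using cell_total[OF u that] E.span_basis by (metis E.span_scale)
        show ?thesis
          by (subst E.rep_sum[OF tot]) (simp_all add: E.rep_scale[OF cell_total[OF u]])
      qed
      also have "\<dots> = 0" using fun_cong[OF 0, of e] by (simp add: \<Phi>_def E.rep_0)
      finally show ?thesis .
    qed
    then show ?thesis using F.sum_rep[OF \<phi>.map_total[OF y_total[of g]]] by simp
  qed
  then have y_im: "?y g \<in> \<phi> (Suc i) ` total sF (F (Suc (Suc i)))" for g
    unfolding \<phi>_exact using y_total by simp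
  have "\<forall>g\<in>A j. \<exists>w. w \<in> F (Suc (Suc i)) (- E.dg j g) \<and> \<phi> (Suc i) w = ?y g"
  proof
    fix g assume g: "g \<in> A j"
    from y_im[of g] obtain w0 where w0: "?y g = \<phi> (Suc i) w0" "w0 \<in> total sF (F (Suc (Suc i)))" ..
    from \<phi>.homogeneous_preimage[OF y[OF g] w0(2) w0(1)[symmetric]]
    show "\<exists>w. w \<in> F (Suc (Suc i)) (- E.dg j g) \<and> \<phi> (Suc i) w = ?y g" by blast
  qed
  from bchoice[OF this] obtain w where
    w': "\<forall>g\<in>A j. w g \<in> F (Suc (Suc i)) (- E.dg j g) \<and> \<phi> (Suc i) (w g) = ?y g" ..
  have w: "w g \<in> F (Suc (Suc i)) (- E.dg j g)" "\<phi> (Suc i) (w g) = ?y g" if "g \<in> A j" for g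
    using w' that by simp_all
  have w_total: "w g \<in> total sF (F (Suc (Suc i)))" if "g \<in> A j" for g
    using w(1)[OF that] F.comp_subset_total by blast
  let ?r = "\<lambda>b g. F.rep (Suc (Suc i)) (w g) b"
  let ?x = "\<lambda>b. \<Sum>g\<in>A j. sE (?r b g) g"
  have "?x \<in> cell (Suc (Suc i)) j"
    unfolding cell_def
  proof (rule boxI)
    fix b assume b: "b \<in> B (Suc (Suc i))"
    show "?x b \<in> E j (- F.dg (Suc (Suc i)) b)"
    proof (rule E.homogeneous_combination)
      fix g assume "g \<in> A j"
      from F.rep_homogeneous[OF w(1)[OF this] b]
      show "homogeneous (?r b g) (- F.dg (Suc (Suc i)) b - E.dg j g)"
        by (subst minus_diff_commute)
    qed
  next
    fix b assume "b \<notin> B (Suc (Suc i))"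
    then show "?x b = 0" by (simp add: F.rep_outside)
  qed
  moreover have "\<Phi> (Suc i) ?x = u"
  proof
    fix e
    show "\<Phi> (Suc i) ?x e = u e"
    proof (cases "e \<in> B (Suc i)")
      case True
      have "\<Phi> (Suc i) ?x e = (\<Sum>b\<in>B (Suc (Suc i)). \<Sum>g\<in>A j. sE (?r b g * \<phi>.mat (Suc i) e b) g)"
        by (simp add: \<Phi>_def E.scale_sum_right mult.commute)
      also have "\<dots> = (\<Sum>g\<in>A j. sE (\<Sum>b\<in>B (Suc (Suc i)). ?r b g * \<phi>.mat (Suc i) e b) g)"
        by (subst sum.swap) (simp add: E.scale_sum_left)
      also have "\<dots> = (\<Sum>g\<in>A j. sE (?q e g) g)"
      proof (rule sum.cong[OF refl])
        fix g assume g: "g \<in> A j"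
        show "sE (\<Sum>b\<in>B (Suc (Suc i)). ?r b g * \<phi>.mat (Suc i) e b) g = sE (?q e g) g"
          unfolding \<phi>.rep_map[OF w_total[OF g], symmetric] w(2)[OF g] rep_y[OF True] ..
      qed
      also have "\<dots> = u e" by (rule E.sum_rep[OF cell_total[OF u True]])
      finally show ?thesis .
    next
      case False
      then show ?thesis using cell_outside[OF u] by (simp add: \<Phi>_def \<phi>.mat_outside)
    qed
  qed
  ultimately show ?thesis by blast
qed

lemma \<Phi>_\<delta>:
  assumes u: "u \<in> cell (Suc i) j" shows "\<Phi> i (\<delta> j \<circ> u) = \<delta> j \<circ> \<Phi> i u"
proof
  fix e
  have tot: "sE p (u b) \<in> total sE (E j)" if "b \<in> B (Suc i)" for b p
    using cell_total[OF u that] E.span_basis by (metis E.span_scale)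
  have "\<delta> j (\<Phi> i u e) = (\<Sum>b\<in>B (Suc i). \<delta> j (sE (\<phi>.mat i e b) (u b)))"
    unfolding \<Phi>_def by (rule \<delta>.map_sum) (rule tot)
  also have "\<dots> = \<Phi> i (\<delta> j \<circ> u) e"
    by (simp add: \<Phi>_def \<delta>.map_scale[OF cell_total[OF u]])
  finally show "\<Phi> i (\<delta> j \<circ> u) e = (\<delta> j \<circ> \<Phi> i u) e" by simp
qed

lemma \<Phi>_degree:
  assumes "\<Phi> i u e \<noteq> 0"
  shows "\<exists>b\<in>B (Suc i). u b \<noteq> 0 \<and> F.dg i e < F.dg (Suc i) b"
proof -
  obtain b where b: "b \<in> B (Suc i)" "sE (\<phi>.mat i e b) (u b) \<noteq> 0"
    using assms unfolding \<Phi>_def by (rule sum.not_neutral_contains_not_neutral)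
  then have "u b \<noteq> 0" "\<phi>.mat i e b \<noteq> 0" by auto
  then show ?thesis using \<phi>.minimal_mat_degree(2)[OF \<phi>_minimal b(1)] b(1) by blast
qed

sublocale dc: graded_double_complex Ksc E \<delta> n B F.dg \<Phi> cell
proof -
  interpret K: vector_space Ksc by (rule vector_space_mconst) unfold_locales
  show "graded_double_complex Ksc E \<delta> n B F.dg \<Phi>"
  proof (unfold_locales, fold cell_def)
    fix i j d x u e
    show "K.subspace (E j d)" by (rule E.subspace_comp)
    show "K.fin_dim (E j d)" by (rule E.fin_dim_comp)
    show "n < j \<Longrightarrow> E j d = {0}" by (rule E_beyond)
    show "linear_on Ksc Ksc (E j d) (\<delta> j)"
      by (rule linear_onI; rule \<delta>.map_add \<delta>.map_scale; erule subsetD[OF E.comp_subset_total])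
    show "x \<in> E j d \<Longrightarrow> \<delta> j x \<in> E (Suc j) d" by (rule \<delta>.map_comp)
    show "x \<in> E j d \<Longrightarrow> \<delta> (Suc j) (\<delta> j x) = 0"
      by (rule \<delta>_\<delta>) (erule subsetD[OF E.comp_subset_total])
    show "finite (B i)" by (rule F.finite_basis)
    show "u \<in> cell (Suc i) j \<Longrightarrow> \<Phi> i u \<in> cell i j" by (rule \<Phi>_in)
    show "\<Phi> i (\<Phi> (Suc i) u) = 0" by (rule \<Phi>_\<Phi>)
    show "u \<in> cell (Suc i) j \<Longrightarrow> \<Phi> i u = 0 \<Longrightarrow> \<exists>w\<in>cell (Suc (Suc i)) j. \<Phi> (Suc i) w = u"
      by (rule \<Phi>_exact)
    show "u \<in> cell (Suc i) j \<Longrightarrow> \<Phi> i (\<delta> j \<circ> u) = \<delta> j \<circ> \<Phi> i u" by (rule \<Phi>_\<delta>)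
    show "\<Phi> i u e \<noteq> 0 \<Longrightarrow> \<exists>e'\<in>B (Suc i). u e' \<noteq> 0 \<and> F.dg i e < F.dg (Suc i) e'"
      by (rule \<Phi>_degree)
    show "linear_on (fun_scale Ksc) (fun_scale Ksc) (cell (Suc i) j) (\<Phi> i)"
      by (rule linear_onI)
        (simp_all add: \<Phi>_def fun_eq_iff fun_scale_apply E.scale_right_distrib sum.distrib
          E.scale_sum_right mult.commute)
  qed
  show "cell i j \<equiv> box (B i) (\<lambda>e. E j (- F.dg i e))" for i j
    by (rule eq_reflection) (rule cell_def)
qed

text \<open>A basis element \<open>b\<close> of \<open>F\<^sub>i\<^sub>+\<^sub>2\<close> is not mapped to \<open>0\<close>: otherwise it would be in the image of the next
  differential, hence in \<open>\<mm> F\<^sub>i\<^sub>+\<^sub>2\<close>, although its own coefficient is \<open>1\<close>. So some matrix entry is nonzero,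
  and \<open>b\<close> has larger degree than some basis element of \<open>F\<^sub>i\<^sub>+\<^sub>1\<close>.\<close>

lemma degree_growth:
  obtains m where "\<And>i b. b \<in> B (Suc i) \<Longrightarrow> m + int i \<le> F.dg (Suc i) b"
proof -
  obtain m where m: "\<And>b. b \<in> B (Suc 0) \<Longrightarrow> m \<le> F.dg (Suc 0) b"
    using F.finite_basis[of "Suc 0"] Min_le[of "F.dg (Suc 0) ` B (Suc 0)"] by (metis finite_imageI imageI)
  have "m + int i \<le> F.dg (Suc i) b" if "b \<in> B (Suc i)" for i b
    using that
  proof (induction i arbitrary: b)
    case 0
    then show ?case using m by simp
  next
    case (Suc i)
    have "\<exists>e. \<phi>.mat (Suc i) e b \<noteq> 0"
    proof (rule ccontr)
      assume "\<not> ?thesis"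
      then have "\<phi> (Suc i) b = 0"
        using F.sum_rep[OF \<phi>.map_basis_total[OF Suc.prems]] by (simp add: \<phi>.mat_def)
      then have "b \<in> \<phi> (Suc (Suc i)) ` total sF (F (Suc (Suc (Suc i))))"
        unfolding \<phi>_exact using \<phi>.basis_in_total[OF Suc.prems] by simp
      then have "b \<in> module.span sF {sF (mvar v) x | v x. x \<in> total sF (F (Suc (Suc i)))}"
        using \<phi>_minimal by blast
      from F.constant_coefficient_maximal_ideal[OF this, of b]
      show False
        using F.representation_basis[OF F.independent_basis Suc.prems] by simp
    qed
    then obtain e where e: "\<phi>.mat (Suc i) e b \<noteq> 0" ..
    from \<phi>.minimal_mat_degree[OF \<phi>_minimal Suc.prems e] Suc.IH[of e]
    show ?case by simp
  qed
  then show thesis using that by blast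
qed

lemma eventually_vanishing:
  obtains Q where "\<And>i b j. Q \<le> i \<Longrightarrow> b \<in> B i \<Longrightarrow> E j (- F.dg i b) = {0}"
proof -
  obtain m where m: "\<And>i b. b \<in> B (Suc i) \<Longrightarrow> m + int i \<le> F.dg (Suc i) b"
    using degree_growth by blast
  have "\<forall>j. \<exists>L. \<forall>d<L. E j d = {0}" using E.bounded_below by metis
  then obtain L where L: "\<And>j d. d < L j \<Longrightarrow> E j d = {0}" by metis
  let ?L = "Min (L ` {..n})"
  have "E j (- F.dg i b) = {0}" if i: "Suc (nat (1 - ?L - m)) \<le> i" and b: "b \<in> B i" for i b j
  proof (cases "j \<le> n")
    case True
    then have "?L \<le> L j" by (intro Min_le) auto
    moreover obtain i' where i': "i = Suc i'" "1 - ?L - m \<le> int i'" using i by (cases i) auto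
    ultimately have "- F.dg i b < L j" using m[of b i'] b by simp
    then show ?thesis by (rule L)
  next
    case False
    then show ?thesis using E_beyond by simp
  qed
  then show thesis using that by blast
qed

end

section \<open>The pairing as a truncated Euler characteristic\<close>

text \<open>A family whose classes form a basis of the quotient is the same as a basis of some complement, and
  all complements of \<open>Y\<close> in \<open>Z\<close> have dimension \<open>dim Z - dim Y\<close>. This makes the definite description
  in \<^const>\<open>quotient_dim\<close> well-defined.\<close>

lemma quotient_dim_eq_dim_complement:
  fixes s :: "('v::finite, 'k::field) mpoly \<Rightarrow> 'm::ab_group_add \<Rightarrow> 'm"
  defines "ksc \<equiv> \<lambda>a. s (mconst a)"
  assumes s: "module s"
    and Z: "module.subspace ksc Z" "vector_space.fin_dim ksc Z"
    and Y: "module.subspace ksc Y" "Y \<subseteq> Z"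
    and W: "vector_space.is_complement ksc Y Z W"
  shows "quotient_dim s Z Y = vector_space.dim ksc W"
proof -
  interpret K: vector_space ksc unfolding ksc_def by (rule vector_space_mconst[OF s])
  have sW: "K.subspace W" "W \<subseteq> Z" "Y \<inter> W = {0}" "\<And>z. z \<in> Z \<Longrightarrow> \<exists>u\<in>Y. \<exists>w\<in>W. z = u + w"
    using W unfolding K.is_complement_def by simp_all
  have dimZ: "K.dim Z = K.dim Y + K.dim W"
    by (rule K.dim_is_complement[OF W Y(1) Z Y(2)])
  have qb: "quotient_basis s Z Y X \<longleftrightarrow> finite X \<and> X \<subseteq> Z \<and> (\<forall>z\<in>Z. \<exists>!a.
      (\<forall>x. x \<notin> X \<longrightarrow> a x = 0) \<and> z - (\<Sum>x\<in>X. ksc (a x) x) \<in> Y)" for X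
    unfolding quotient_basis_def ksc_def ..
  have zeroY: "0 \<in> Y" and zeroZ: "0 \<in> Z" using K.subspace_0 Y(1) Z(1) by blast+
  \<comment> \<open>the span of such a family is a complement, because only the zero family has a combination in \<open>Y\<close>\<close>
  have card: "card X = K.dim W" if X: "quotient_basis s Z Y X" for X
  proof -
    have fin: "finite X" and XZ: "X \<subseteq> Z" using X qb by blast+
    have unique: "f x = 0" if f: "(\<Sum>x\<in>X. ksc (f x) x) \<in> Y" and x: "x \<in> X" for f x
    proof -
      let ?P = "\<lambda>a. (\<forall>x. x \<notin> X \<longrightarrow> a x = 0) \<and> 0 - (\<Sum>x\<in>X. ksc (a x) x) \<in> Y"
      let ?f = "\<lambda>x. if x \<in> X then f x else 0"
      have ex1: "\<exists>!a. ?P a" using X zeroZ unfolding qb by blast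
      have Pf: "?P ?f" using K.subspace_neg[OF Y(1) f] by simp
      have P0: "?P (\<lambda>x. 0)" using zeroY by simp
      have "?f = (\<lambda>x. 0)"
      proof (rule ex1E[OF ex1])
        fix a assume a: "\<forall>a'. ?P a' \<longrightarrow> a' = a"
        show ?thesis
          using mp[OF spec[OF a, of ?f] Pf] mp[OF spec[OF a, of "\<lambda>x. 0"] P0] by simp
      qed
      from fun_cong[OF this, of x] x show ?thesis by simp
    qed
    have ind: "K.independent X"
    proof (rule K.independent_if_scalars_zero[OF fin])
      fix f x assume "(\<Sum>x\<in>X. ksc (f x) x) = 0" "x \<in> X"
      with unique[of f x] zeroY show "f x = 0" by simp
    qed
    have "K.is_complement Y Z (K.span X)"
      unfolding K.is_complement_def
    proof (intro conjI ballI)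
      show "K.span X \<subseteq> Z" using XZ Z(1) by (rule K.span_minimal)
      show "Y \<inter> K.span X = {0}"
      proof
        show "Y \<inter> K.span X \<subseteq> {0}"
        proof
          fix w assume w: "w \<in> Y \<inter> K.span X"
          then obtain f where f: "w = (\<Sum>x\<in>X. ksc (f x) x)" unfolding K.span_finite[OF fin] by blast
          then have "f x = 0" if "x \<in> X" for x using unique[of f x] w that by simp
          then show "w \<in> {0}" using f by simp
        qed
      qed (use zeroY K.span_zero in simp)
      fix z assume "z \<in> Z"
      then obtain a where a: "z - (\<Sum>x\<in>X. ksc (a x) x) \<in> Y" using X unfolding qb by blast
      have "(\<Sum>x\<in>X. ksc (a x) x) \<in> K.span X" by (intro K.span_sum K.span_scale K.span_base)
      with a show "\<exists>u\<in>Y. \<exists>w\<in>K.span X. z = u + w"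
        by (intro bexI[of _ "z - (\<Sum>x\<in>X. ksc (a x) x)"] bexI[of _ "\<Sum>x\<in>X. ksc (a x) x"]) simp_all
    qed simp
    from K.dim_is_complement[OF this Y(1) Z Y(2)] dimZ
    show ?thesis using K.dim_span_eq_card_independent[OF ind] by simp
  qed
  have "\<exists>X. quotient_basis s Z Y X"
  proof -
    obtain X where X: "X \<subseteq> W" "K.independent X" "W \<subseteq> K.span X" "card X = K.dim W"
      by (rule K.basis_exists[of W])
    have fin: "finite X"
      using K.fin_dim_independent_finite[OF K.fin_dim_subset[OF Z(2) sW(2)] X(2,1)] .
    have ex1: "\<exists>!a. (\<forall>x. x \<notin> X \<longrightarrow> a x = 0) \<and> z - (\<Sum>x\<in>X. ksc (a x) x) \<in> Y" if z: "z \<in> Z" for z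
    proof -
      obtain u w where uw: "u \<in> Y" "w \<in> W" "z = u + w" using sW(4)[OF z] by blast
      then obtain f where f: "w = (\<Sum>x\<in>X. ksc (f x) x)"
        using X(3) unfolding K.span_finite[OF fin] by blast
      let ?f = "\<lambda>x. if x \<in> X then f x else 0"
      show ?thesis
      proof (rule ex1I[of _ ?f])
        show "(\<forall>x. x \<notin> X \<longrightarrow> ?f x = 0) \<and> z - (\<Sum>x\<in>X. ksc (?f x) x) \<in> Y"
          using uw f by simp
        fix a assume a: "(\<forall>x. x \<notin> X \<longrightarrow> a x = 0) \<and> z - (\<Sum>x\<in>X. ksc (a x) x) \<in> Y"
        have diff: "(\<Sum>x\<in>X. ksc (f x - a x) x) = w - (\<Sum>x\<in>X. ksc (a x) x)"
          using f by (simp add: K.scale_left_diff_distrib sum_subtractf)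
        also have "\<dots> = (z - (\<Sum>x\<in>X. ksc (a x) x)) - u" using uw(3) by simp
        also have "\<dots> \<in> Y" using K.subspace_diff[OF Y(1)] a uw(1) by blast
        finally have "(\<Sum>x\<in>X. ksc (f x - a x) x) \<in> Y" .
        moreover have "(\<Sum>x\<in>X. ksc (f x - a x) x) \<in> W"
          using X(1) by (intro K.subspace_sum[OF sW(1)] K.subspace_scale[OF sW(1)]) blast
        ultimately have "(\<Sum>x\<in>X. ksc (f x - a x) x) = 0" using sW(3) by blast
        then have "f x - a x = 0" if "x \<in> X" for x
          using K.independentD[OF X(2) fin order_refl _ that, of "\<lambda>x. f x - a x"] by simp
        then show "a = ?f" using a by (auto simp: fun_eq_iff)
      qed
    qed
    have "X \<subseteq> Z" using X(1) sW(2) by (rule subset_trans)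
    then have "quotient_basis s Z Y X"
      unfolding qb by (intro conjI ballI fin ex1)
    then show ?thesis ..
  qed
  then obtain X where X: "quotient_basis s Z Y X" ..
  show ?thesis
    unfolding quotient_dim_def
  proof (rule the_equality)
    show "\<exists>X. quotient_basis s Z Y X \<and> card X = K.dim W" using X card[OF X] by blast
    show "r = K.dim W" if "\<exists>X. quotient_basis s Z Y X \<and> card X = r" for r using that card by blast
  qed
qed

context complex_and_resolution
begin

lemma cohomology_dim_eq: "cohomology_dim sE E \<delta> j d = dc.h j d"
proof -
  have "module sE" by unfold_locales
  then show ?thesis
    unfolding cohomology_dim_def dc.h_def
    by (rule quotient_dim_eq_dim_complement)
      (rule dc.rank_nullity_\<delta> dc.fin_dim_cocyc dc.cobd_subset_cocyc dc.H_complement)+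
qed

lemma h_eq_0: "E j d = {0} \<Longrightarrow> dc.h j d = 0"
  using dc.dim_E[of j d] by simp

lemma sum_over_degrees:
  assumes "finite K" "F.dg i ` B i \<subseteq> K"
  shows "(\<Sum>k\<in>K. int (card {b \<in> B i. F.dg i b = k}) * g k) = (\<Sum>b\<in>B i. g (F.dg i b))"
proof -
  have "(\<Sum>k\<in>K. int (card {b \<in> B i. F.dg i b = k}) * g k)
      = (\<Sum>k\<in>K. \<Sum>b\<in>{b \<in> B i. F.dg i b = k}. g (F.dg i b))"
    by (intro sum.cong refl) simp
  also have "\<dots> = (\<Sum>b\<in>B i. g (F.dg i b))"
    by (rule sum.group[OF F.finite_basis assms])
  finally show ?thesis .
qed

text \<open>Reindexing by \<open>p = i - j\<close> and replacing sums over degrees, weighted by Betti numbers, by sums over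
  basis elements identifies the pairing with the sum in \<open>truncated_euler_characteristic_nonneg\<close>.\<close>

theorem pairing_nonneg:
  assumes \<tau>: "\<tau> \<le> n"
  defines "\<beta> \<equiv> \<lambda>i k. card {b \<in> B i. F.dg i b = k}"
  shows "0 \<le> pairing \<beta> dc.h c \<tau>"
proof -
  obtain Q where Q: "\<And>i b j. Q \<le> i \<Longrightarrow> b \<in> B i \<Longrightarrow> E j (- F.dg i b) = {0}"
    using eventually_vanishing by blast
  let ?P = "Suc (Suc Q)"
  \<comment> \<open>a finite set containing every degree that contributes to either sum\<close>
  define K where "K = (\<Union>i\<le>?P + n + 1. F.dg i ` B i)"
  have finK: "finite K" using F.finite_basis by (simp add: K_def)
  have subK: "F.dg i ` B i \<subseteq> K" if "i \<le> ?P + n + 1" for i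
    unfolding K_def using that by blast
  have in_K: "k \<in> K" if "\<beta> i k \<noteq> 0" "i \<le> ?P + n + 1" for i k
  proof -
    have "{b \<in> B i. F.dg i b = k} \<noteq> {}" using that(1) unfolding \<beta>_def by (metis card.empty)
    then show ?thesis using subK[OF that(2)] by blast
  qed
  have n: "j \<le> n" if "dc.h j d \<noteq> 0" for j d
    using that h_eq_0[OF E_beyond] by (meson not_le)
  have i: "i < Q" if "\<beta> i k \<noteq> 0" "dc.h j (- k) \<noteq> 0" for i j k
  proof (rule ccontr)
    assume "\<not> i < Q"
    have "{b \<in> B i. F.dg i b = k} \<noteq> {}" using that(1) unfolding \<beta>_def by (metis card.empty)
    then obtain b where "b \<in> B i" "F.dg i b = k" by blast
    with Q[of i b j] \<open>\<not> i < Q\<close> h_eq_0[of j "- k"] that(2) show False by simp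
  qed
  define f where "f = (\<lambda>(i, j, k). ((-1) ^ (i - j) * int (\<beta> i k) * int (dc.h j (- k)))
      when (j \<le> i \<and> (j < \<tau> \<or> j + 2 \<le> i)))"
  define g where "g = (\<lambda>(i, j, k, \<epsilon>::nat). ((-1) ^ (i - j) * int (\<beta> i k) * int (dc.h j (- k)))
      when (\<epsilon> \<le> 1 \<and> j = \<tau> \<and> i = j + \<epsilon> \<and> k \<le> c + int \<epsilon>))"
  let ?hs = "\<lambda>p j. int (dc.hsum p j)"
  have hs: "(\<Sum>k\<in>K. int (\<beta> (j + p) k) * int (dc.h j (- k))) = ?hs p j" if "p < ?P" "j \<le> n" for p j
    unfolding \<beta>_def dc.hsum_def using that by (subst sum_over_degrees[OF finK subK]) simp_all
  have "Sum_any f = (\<Sum>p<?P. \<Sum>j\<le>n. if j < \<tau> \<or> 2 \<le> p then (-1) ^ p * ?hs p j else 0)"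
  proof -
    let ?S = "{..<?P} \<times> {..n} \<times> K"
    let ?r = "\<lambda>(p, j, k). (j + p, j, k)"
    have inj: "inj_on ?r ?S" by (auto simp: inj_on_def)
    have "Sum_any f = sum f (?r ` ?S)"
    proof (rule Sum_any.expand_superset)
      show "finite (?r ` ?S)" using finK by simp
      show "{x. f x \<noteq> 0} \<subseteq> ?r ` ?S"
      proof clarify
        fix i j k assume "f (i, j, k) \<noteq> 0"
        then have *: "j \<le> i" "\<beta> i k \<noteq> 0" "dc.h j (- k) \<noteq> 0" by (simp_all add: f_def)
        have "i < Q" "j \<le> n" by (rule i[OF *(2,3)] n[OF *(3)])+
        moreover from this have "k \<in> K" using in_K[OF *(2)] by simp
        ultimately have "(i - j, j, k) \<in> ?S" by auto
        moreover have "(i, j, k) = ?r (i - j, j, k)" using * by simp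
        ultimately show "(i, j, k) \<in> ?r ` ?S" by (rule rev_image_eqI)
      qed
    qed
    also have "\<dots> = (\<Sum>x\<in>?S. f (?r x))" using sum.reindex[OF inj] by simp
    also have "\<dots> = (\<Sum>p<?P. \<Sum>j\<le>n. \<Sum>k\<in>K. f (j + p, j, k))"
      by (simp add: sum.cartesian_product split_beta)
    also have "\<dots> = (\<Sum>p<?P. \<Sum>j\<le>n. if j < \<tau> \<or> 2 \<le> p then (-1) ^ p * ?hs p j else 0)"
    proof (intro sum.cong refl)
      fix p j assume "p \<in> {..<?P}" "j \<in> {..n}"
      then have "?hs p j = (\<Sum>k\<in>K. int (\<beta> (j + p) k) * int (dc.h j (- k)))" using hs by simp
      then show "(\<Sum>k\<in>K. f (j + p, j, k)) = (if j < \<tau> \<or> 2 \<le> p then (-1) ^ p * ?hs p j else 0)"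
        by (simp add: f_def sum_distrib_left mult.assoc)
    qed
    finally show ?thesis .
  qed
  also have "\<dots> = (\<Sum>q<Q. (-1) ^ q * int (\<Sum>j\<le>n. dc.hsum (Suc (Suc q)) j))
      + (\<Sum>j<\<tau>. ?hs 0 j - ?hs (Suc 0) j)"
  proof -
    have low: "(\<Sum>j\<le>n. if j < \<tau> then u j else 0) = (\<Sum>j<\<tau>. u j)" for u :: "nat \<Rightarrow> int"
    proof -
      have "{j \<in> {..n}. j < \<tau>} = {..<\<tau>}" using \<tau> by auto
      then show ?thesis by (simp add: sum.inter_filter[symmetric])
    qed
    show ?thesis
      unfolding sum.lessThan_Suc_shift
      by (simp add: low sum_subtractf sum_negf sum_distrib_left)
  qed
  finally have first: "Sum_any f = \<dots>" .
  have "Sum_any g = int (\<Sum>e\<in>{e \<in> B \<tau>. F.dg \<tau> e \<le> c}. dc.h \<tau> (- F.dg \<tau> e))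
    - int (\<Sum>e\<in>{e \<in> B (Suc \<tau>). F.dg (Suc \<tau>) e \<le> c + 1}. dc.h \<tau> (- F.dg (Suc \<tau>) e))"
  proof -
    let ?S = "{0, 1} \<times> K"
    let ?r = "\<lambda>(\<epsilon>, k). (\<tau> + \<epsilon>, \<tau>, k, \<epsilon>)"
    have inj: "inj_on ?r ?S" by (auto simp: inj_on_def)
    have "Sum_any g = sum g (?r ` ?S)"
    proof (rule Sum_any.expand_superset)
      show "finite (?r ` ?S)" using finK by simp
      show "{x. g x \<noteq> 0} \<subseteq> ?r ` ?S"
      proof clarify
        fix i j k \<epsilon> assume "g (i, j, k, \<epsilon>) \<noteq> 0"
        then have *: "\<epsilon> \<le> 1" "j = \<tau>" "i = \<tau> + \<epsilon>" "\<beta> i k \<noteq> 0" by (auto simp: g_def)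
        then have "k \<in> K" using in_K[of i k] \<tau> by simp
        then have "(\<epsilon>, k) \<in> ?S" using * by auto
        moreover have "(i, j, k, \<epsilon>) = ?r (\<epsilon>, k)" using * by simp
        ultimately show "(i, j, k, \<epsilon>) \<in> ?r ` ?S" by (rule rev_image_eqI)
      qed
    qed
    also have "\<dots> = (\<Sum>x\<in>?S. g (?r x))" using sum.reindex[OF inj] by simp
    also have "\<dots> = (\<Sum>\<epsilon>\<in>{0, 1}. \<Sum>k\<in>K. g (\<tau> + \<epsilon>, \<tau>, k, \<epsilon>))"
      unfolding sum.cartesian_product by (rule sum.cong) auto
    also have "\<dots> = (\<Sum>k\<in>K. int (\<beta> \<tau> k) * (if k \<le> c then int (dc.h \<tau> (- k)) else 0))
        - (\<Sum>k\<in>K. int (\<beta> (Suc \<tau>) k) * (if k \<le> c + 1 then int (dc.h \<tau> (- k)) else 0))"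
      by (simp add: g_def when_def if_distrib sum_negf[symmetric] cong: if_cong)
    also have "(\<Sum>k\<in>K. int (\<beta> \<tau> k) * (if k \<le> c then int (dc.h \<tau> (- k)) else 0))
        = (\<Sum>e\<in>B \<tau>. if F.dg \<tau> e \<le> c then int (dc.h \<tau> (- F.dg \<tau> e)) else 0)"
      unfolding \<beta>_def using \<tau> by (intro sum_over_degrees[OF finK subK]) simp
    also have "(\<Sum>k\<in>K. int (\<beta> (Suc \<tau>) k) * (if k \<le> c + 1 then int (dc.h \<tau> (- k)) else 0))
        = (\<Sum>e\<in>B (Suc \<tau>). if F.dg (Suc \<tau>) e \<le> c + 1 then int (dc.h \<tau> (- F.dg (Suc \<tau>) e)) else 0)"
      unfolding \<beta>_def using \<tau> by (intro sum_over_degrees[OF finK subK]) simp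
    finally show ?thesis
      by (simp add: sum.inter_filter[OF F.finite_basis] if_distrib[of int] cong: if_cong)
  qed
  moreover have "pairing \<beta> dc.h c \<tau> = Sum_any f + Sum_any g"
    unfolding pairing_def f_def g_def ..
  ultimately show ?thesis
    using first dc.truncated_euler_characteristic_nonneg[OF \<tau>, where Q = Q and c = c, OF Q] by linarith
qed

end

theorem theorem4p1:
  fixes sE :: "('v::finite, 'k::field) mpoly \<Rightarrow> 'e::ab_group_add \<Rightarrow> 'e"
    and E :: "nat \<Rightarrow> int \<Rightarrow> 'e set" and \<delta> :: "nat \<Rightarrow> 'e \<Rightarrow> 'e"
    and sM :: "('v, 'k) mpoly \<Rightarrow> 'm::ab_group_add \<Rightarrow> 'm" and M :: "int \<Rightarrow> 'm set"
    and sF :: "('v, 'k) mpoly \<Rightarrow> 'f::ab_group_add \<Rightarrow> 'f"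
    and F :: "nat \<Rightarrow> int \<Rightarrow> 'f set" and \<phi> :: "nat \<Rightarrow> 'f \<Rightarrow> 'f" and \<pi> :: "'f \<Rightarrow> 'm"
    and \<beta> :: "nat \<Rightarrow> int \<Rightarrow> nat" and c :: int and \<tau> :: nat
  assumes "free_complex CARD('v) sE E \<delta>"
    and "\<tau> \<le> CARD('v)"
    and "graded_module sM M" and "finitely_generated sM M"
    and "minimal_free_resolution sF F \<phi> sM M \<pi>"
    and "betti_diagram sF F \<beta>"
  shows "pairing \<beta> (cohomology_dim sE E \<delta>) c \<tau> \<ge> 0"
proof -
  have "\<forall>j. \<exists>A. graded_free sE (E j) A"
    using assms(1) unfolding free_complex_def fg_graded_free_def
    by (blast intro: graded_free.intro graded_free_axioms.intro)
  from choice[OF this] obtain A where A: "\<And>j. graded_free sE (E j) (A j)" by blast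
  have res: "free_resolution sF F \<phi> sM M \<pi>"
    using assms(5) by (simp add: minimal_free_resolution_def)
  have "\<forall>i. \<exists>B. graded_free sF (F i) B \<and> (\<forall>k. \<beta> i k = card (B \<inter> F i k))"
    using res assms(6) unfolding free_resolution_def fg_graded_free_def betti_diagram_def
    by (meson graded_free.intro graded_free_axioms.intro)
  from choice[OF this] obtain B where
    B: "\<And>i. graded_free sF (F i) (B i)" "\<And>i k. \<beta> i k = card (B i \<inter> F i k)" by blast
  interpret complex_and_resolution sE E \<delta> "CARD('v)" A sF F \<phi> B
  proof (rule complex_and_resolution.intro)
    fix i j d x
    show "graded_free sE (E j) (A j)" by (rule A)
    show "graded_free sF (F i) (B i)" by (rule B(1))
    show "CARD('v) < j \<Longrightarrow> E j d = {0}" "graded_hom sE (E j) sE (E (Suc j)) (\<delta> j)"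
      "x \<in> total sE (E j) \<Longrightarrow> \<delta> (Suc j) (\<delta> j x) = 0"
      using assms(1) by (simp_all add: free_complex_def)
    show "graded_hom sF (F (Suc i)) sF (F i) (\<phi> i)"
      "\<phi> (Suc i) ` total sF (F (Suc (Suc i))) = {x \<in> total sF (F (Suc i)). \<phi> i x = 0}"
      using res by (simp_all add: free_resolution_def)
    show "\<phi> i ` total sF (F (Suc i)) \<subseteq> module.span sF {sF (mvar v) x | v x. x \<in> total sF (F i)}"
      using assms(5) by (simp add: minimal_free_resolution_def)
  qed
  have "B i \<inter> F i k = {b \<in> B i. F.dg i b = k}" for i k
    using F.basis_degree[of _ i k] by auto
  then have "\<beta> = (\<lambda>i k. card {b \<in> B i. F.dg i b = k})"
    using B(2) by (simp add: fun_eq_iff)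
  moreover have "cohomology_dim sE E \<delta> = dc.h"
    by (simp add: fun_eq_iff cohomology_dim_eq)
  ultimately show ?thesis using pairing_nonneg[OF assms(2), of c] by simp
qed

end
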